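(* Let $\vec{\mathbb{T}}=(\mathbb{V},\vec{\mathbb{E}})$ be a directed tree in which each vertex has exactly one parent and at least one child, and consider the locally uniform monotone function model on $\vec{\mathbb{T}}$. Then the map $\phi\mapsto\mu_\phi$, sending a flow $\phi$ to its associated flow measure $\mu_\phi$, is a bijection from the set of flows on $\vec{\mathbb{T}}$ to the set of extremal gradient Gibbs measures.
   Context: Write $p(x)$ for the parent of $x\in\mathbb{V}$; $xy\in\vec{\mathbb{E}}$ means that $x$ is the child and $y=p(x)$ is the parent. A monotone function is $h:\mathbb{V}\to\mathbb{Z}$ with $h(y)-h(x)\ge 0$ for all $xy\in\vec{\mathbb{E}}$; the set of these is $\operatorname{Mon}(\vec{\mathbb{T}},\mathbb{Z})$. Let $\Omega=\mathbb{Z}^{\mathbb{V}}$ with product sigma-algebra $\mathcal{F}$. Specification: for every finite $\Lambda\subset\mathbb{V}$ and $b\in\operatorname{Mon}(\vec{\mathbb{T}},\mathbb{Z})$, $\gamma_\Lambda(\cdot,b)$ is the uniform probability measure on the finite set $\{h\in\operatorname{Mon}(\vec{\mathbb{T}},\mathbb{Z}): h|_{\mathbb{V}\setminus\Lambda}=b|_{\mathbb{V}\setminus\Lambda}\}$. Let $\mathcal{F}^\nabla\subset\mathcal{F}$ be the sigma-algebra generated by all height differences $h(y)-h(z)$, $y,z\in\mathbb{V}$. A gradient Gibbs measure is a probability measure $\mu$ on $(\Omega,\mathcal{F}^\nabla)$ that is supported on $\operatorname{Mon}(\vec{\mathbb{T}},\mathbb{Z})$ and satisfies $\mu\gamma_\Lambda=\mu$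 on $\mathcal{F}^\nabla$ for every finite $\Lambda\subset\mathbb{V}$, where $\mu\gamma_\Lambda(A)=\int\gamma_\Lambda(A,b)\,d\mu(b)$. Let $\mathcal{T}=\bigcap_\Lambda\sigma(h(y):y\in\mathbb{V}\setminus\Lambda)$ (over finite $\Lambda$) be the tail sigma-algebra and $\mathcal{T}^\nabla=\mathcal{T}\cap\mathcal{F}^\nabla$. A gradient Gibbs measure is extremal if it is trivial on $\mathcal{T}^\nabla$ (every event has probability $0$ or $1$). A flow on $\vec{\mathbb{T}}$ is a map $\phi:\vec{\mathbb{E}}\to(0,\infty]$ such that $\phi_{xp(x)}=\sum_{y:\,yx\in\vec{\mathbb{E}}}\phi_{yx}$ for all $x\in\mathbb{V}$. For $\alpha\in(0,\infty]$, $\operatorname{Geom}(\alpha)$ is the distribution on $\mathbb{Z}_{\ge0}$ for which the probability of $k$ is proportional to $e^{-k\alpha}$ (for $\alpha=\infty$: the Dirac mass at $0$). The flow measure $\mu_\phi$ is the probability measure on $(\Omega,\mathcal{F}^\nabla)$ under which $(h(y)-h(x))_{xy\in\vec{\mathbb{E}}}$ is a family of independent random variables with $h(y)-h(x)\sim\operatorname{Geom}(\phi_{xy})$. *)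

theory Defs
  imports "HOL-Probability.Probability"
begin

text \<open>A directed graph on the vertex set \<^term>\<open>UNIV :: 'v set\<close> is given by its set of edges \<open>E\<close>,
  where \<open>(x, y) \<in> E\<close> means that \<open>x\<close> is a child of \<open>y\<close>. It is a directed tree if it is an
  orientation of an undirected simple graph which is connected and has no cycles.\<close>

definition adjacent :: "('v \<times> 'v) set \<Rightarrow> 'v \<Rightarrow> 'v \<Rightarrow> bool" where
  "adjacent E x y \<longleftrightarrow> (x, y) \<in> E \<or> (y, x) \<in> E"

definition undirected_cycle :: "('v \<times> 'v) set \<Rightarrow> 'v list \<Rightarrow> bool" where
  "undirected_cycle E xs \<longleftrightarrow>
     length xs \<ge> 3 \<and> distinct xs \<and> successively (adjacent E) xs \<and> adjacent E (last xs) (hd xs)"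

locale directed_tree =
  fixes E :: "('v \<times> 'v) set"
  assumes oriented: "(x, y) \<in> E \<Longrightarrow> (y, x) \<notin> E" \<comment> \<open>for \<open>x = y\<close> this excludes loops\<close>
    and connected: "(adjacent E)\<^sup>*\<^sup>* x y"
    and no_cycle: "\<not> undirected_cycle E xs"

definition Mon :: "('v \<times> 'v) set \<Rightarrow> ('v \<Rightarrow> int) set" where
  "Mon E = {h. \<forall>(x, y)\<in>E. 0 \<le> h y - h x}"

text \<open>If every vertex has exactly one parent and at least one child, then the set below is finite
  and nonempty for finite \<open>\<Lambda>\<close> and \<open>b \<in> Mon E\<close>. For \<open>b \<notin> Mon E\<close> it may be empty and then
  \<open>pmf_of_set\<close> is unspecified, so \<open>gibbs_kernel\<close> is only used for \<open>b \<in> Mon E\<close>.\<close>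

definition gibbs_kernel :: "('v \<times> 'v) set \<Rightarrow> 'v set \<Rightarrow> ('v \<Rightarrow> int) \<Rightarrow> ('v \<Rightarrow> int) pmf" where
  "gibbs_kernel E \<Lambda> b = pmf_of_set {h \<in> Mon E. \<forall>v. v \<notin> \<Lambda> \<longrightarrow> h v = b v}"

definition gradient_algebra :: "('v \<Rightarrow> int) measure" where
  "gradient_algebra = sigma UNIV {{h. h y - h z \<in> B} | y z B. True}"

definition tail_sets :: "('v \<Rightarrow> int) set set" where
  "tail_sets = (\<Inter>\<Lambda>\<in>{\<Lambda>. finite \<Lambda>}. sigma_sets UNIV {{h. h y \<in> B} | y B. y \<notin> \<Lambda>})"

definition gradient_tail_sets :: "('v \<Rightarrow> int) set set" where
  "gradient_tail_sets = tail_sets \<inter> sets gradient_algebra"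

text \<open>The integral below is over \<open>Mon E\<close>, which carries the full mass of \<open>\<mu>\<close>.\<close>

definition gradient_gibbs :: "('v \<times> 'v) set \<Rightarrow> ('v \<Rightarrow> int) measure \<Rightarrow> bool" where
  "gradient_gibbs E \<mu> \<longleftrightarrow>
     prob_space \<mu> \<and> space \<mu> = UNIV \<and> sets \<mu> = sets gradient_algebra \<and>
     (AE h in \<mu>. h \<in> Mon E) \<and>
     (\<forall>\<Lambda>. finite \<Lambda> \<longrightarrow> (\<forall>A\<in>sets gradient_algebra.
        (\<integral>\<^sup>+b\<in>Mon E. emeasure (measure_pmf (gibbs_kernel E \<Lambda> b)) A \<partial>\<mu>) = emeasure \<mu> A))"

definition extremal_gradient_gibbs :: "('v \<times> 'v) set \<Rightarrow> ('v \<Rightarrow> int) measure \<Rightarrow> bool" where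
  "extremal_gradient_gibbs E \<mu> \<longleftrightarrow>
     gradient_gibbs E \<mu> \<and> (\<forall>A\<in>gradient_tail_sets. measure \<mu> A = 0 \<or> measure \<mu> A = 1)"

text \<open>Flows are functions on \<open>E\<close> only: membership in the dependent function space fixes the
  irrelevant values outside \<open>E\<close>. The (possibly infinite) sum is taken in \<open>[0, \<infinity>]\<close>.\<close>

definition flows :: "('v \<times> 'v) set \<Rightarrow> ('v \<times> 'v \<Rightarrow> ennreal) set" where
  "flows E = {\<phi> \<in> E \<rightarrow>\<^sub>E {0<..}. \<forall>(x, y)\<in>E. \<phi> (x, y) = (\<Sum>\<^sub>\<infinity>z\<in>{z. (z, x) \<in> E}. \<phi> (z, x))}"

text \<open>\<open>Geom \<alpha>\<close>, for \<open>\<alpha> \<in> (0, \<infinity>]\<close>, has mass at \<open>k\<close> proportional to \<open>exp (- k \<alpha>)\<close>; see \<open>pmf_Geom\<close>.\<close>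

definition Geom :: "ennreal \<Rightarrow> nat pmf" where
  "Geom \<alpha> = (if \<alpha> = \<infinity> then return_pmf 0 else geometric_pmf (1 - exp (- enn2real \<alpha>)))"

lemma pmf_Geom:
  assumes "0 < \<alpha>" "\<alpha> < \<infinity>"
  shows "pmf (Geom \<alpha>) k = (1 - exp (- enn2real \<alpha>)) * exp (- (real k * enn2real \<alpha>))"
proof -
  have "0 < enn2real \<alpha>"
    using assms by (simp add: enn2real_positive_iff)
  then have "1 - exp (- enn2real \<alpha>) \<in> {0<..1}"
    by auto
  moreover have "exp (- enn2real \<alpha>) ^ k = exp (- (real k * enn2real \<alpha>))"
    by (simp flip: exp_of_nat_mult)
  ultimately show ?thesis
    using assms by (simp add: Geom_def)
qed

definition is_flow_measure ::
    "('v \<times> 'v) set \<Rightarrow> ('v \<times> 'v \<Rightarrow> ennreal) \<Rightarrow> ('v \<Rightarrow> int) measure \<Rightarrow> bool" where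
  "is_flow_measure E \<phi> \<mu> \<longleftrightarrow>
     prob_space \<mu> \<and> space \<mu> = UNIV \<and> sets \<mu> = sets gradient_algebra \<and>
     prob_space.indep_vars \<mu> (\<lambda>_. count_space UNIV) (\<lambda>(x, y) h. h y - h x) E \<and>
     (\<forall>(x, y)\<in>E. distr \<mu> (count_space UNIV) (\<lambda>h. h y - h x) =
        measure_pmf (map_pmf int (Geom (\<phi> (x, y)))))"

definition flow_measure ::
    "('v \<times> 'v) set \<Rightarrow> ('v \<times> 'v \<Rightarrow> ennreal) \<Rightarrow> ('v \<Rightarrow> int) measure" where
  "flow_measure E \<phi> = (THE \<mu>. is_flow_measure E \<phi> \<mu>)"

end

theory Submission
  imports Defs
begin

text \<open>
  Let \<open>p\<close> be the parent map and \<open>M\<close> the set of monotone functions. A measure is a gradient Gibbs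
  measure iff it is invariant under adding any finitely supported function, as long as one stays
  in \<open>M\<close>. Adding \<open>1\<close> on all descendants of \<open>x\<close> lowers the increment \<open>h (p x) - h x\<close> by one and
  changes no other increment. This is not a finite modification, but on a local event it agrees with
  one, so for every invariant measure \<open>\<mu>\<close> the image of \<open>\<mu>\<close> under this map (restricted to a positive
  increment) is dominated by \<open>\<mu>\<close>. If \<open>\<mu>\<close> is extremal, the density of the image is invariant,
  hence constant: the increment at \<open>x\<close> is memoryless jointly with all others, so the increments
  are independent and geometric. Adding \<open>1\<close> at \<open>x\<close> alone exchanges the event that the increment at
  \<open>x\<close> is positive with the event that those at all its children are, which is the flow equation.
  Conversely the flow equation gives invariance at single sites, which generate all finite
  modifications. For a tail event \<open>A\<close> the domination, applied to \<open>\<mu>\<close> restricted to \<open>A\<close> and to its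
  complement, shows that \<open>A\<close> is almost surely stable under the infinite shifts. Then \<open>\<mu>\<close>
  restricted to \<open>A\<close> is memoryless too, so it is a multiple of \<open>\<mu>\<close> and \<open>A\<close> is trivial.
\<close>

text \<open>Only an inequality survives when the infinite shift is replaced by a finite one: the
  finite shift also raises the increments just below its support, so it does not fill the target
  event. Equality is recovered from total masses. If \<open>c\<close> is the total mass of the
  image, extremality gives a density of at most \<open>c\<close>, and applying this bound to an
  event and to its complement leaves no room for a strict inequality. \<open>M\<close> is not stable
  under finite modifications, so a superlevel set of the density is invariant only almost surely and
  only inside \<open>M\<close>; an exactly invariant version has to be built before triviality on
  the tail applies. All laws are compared on the events \<open>cyl J k\<close>, which bound finitely
  many increments from below. They form a pi-system, lowering an increment shifts one bound, and
  under geometric laws their probabilities are products of powers of exp(-alpha). In these terms the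
  flow equation is multiplicative and an infinite flow is the ratio 0. Infinitely many children are
  handled by limits along an enumeration.\<close>

definition translate :: "('v \<Rightarrow> int) \<Rightarrow> ('v \<Rightarrow> int) \<Rightarrow> 'v \<Rightarrow> int" where
  "translate d h = (\<lambda>v. h v + d v)"

lemma translate_translate [simp]: "translate d (translate d' h) = translate (\<lambda>v. d v + d' v) h"
  by (simp add: translate_def algebra_simps)

lemma translate_zero [simp]: "translate (\<lambda>_. 0) h = h"
  by (simp add: translate_def)

lemma translate_vimage: "translate d' -` translate d -` A = translate (\<lambda>v. d v + d' v) -` A"
  by auto

text \<open>Countability lets intersections over all finite modifications stay measurable and lets
  almost sure statements hold for all of them at once.\<close>

lemma countable_finite_support: "countable {d :: 'v::countable \<Rightarrow> int. finite {v. d v \<noteq> 0}}"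
proof -
  let ?E = "\<lambda>\<Lambda>. (\<lambda>f v. if v \<in> \<Lambda> then f v else 0) ` (\<Lambda> \<rightarrow>\<^sub>E UNIV) :: ('v \<Rightarrow> int) set"
  have "{d :: 'v \<Rightarrow> int. finite {v. d v \<noteq> 0}} \<subseteq> (\<Union>\<Lambda>\<in>Collect finite. ?E \<Lambda>)"
  proof
    fix d :: "'v \<Rightarrow> int" assume "d \<in> {d. finite {v. d v \<noteq> 0}}"
    moreover have "d = (\<lambda>v. if v \<in> {v. d v \<noteq> 0} then restrict d {v. d v \<noteq> 0} v else 0)" by auto
    moreover have "restrict d {v. d v \<noteq> 0} \<in> {v. d v \<noteq> 0} \<rightarrow>\<^sub>E UNIV" by auto
    ultimately show "d \<in> (\<Union>\<Lambda>\<in>Collect finite. ?E \<Lambda>)" by blast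
  qed
  moreover have "countable (\<Union>\<Lambda>\<in>Collect finite. ?E \<Lambda>)"
    by (intro countable_UN countable_Collect_finite countable_image countable_PiE) auto
  ultimately show ?thesis by (rule countable_subset)
qed

subsection \<open>The gradient sigma-algebra\<close>

lemma space_gradient [simp]: "space gradient_algebra = UNIV"
  by (simp add: gradient_algebra_def space_measure_of_conv)

lemma sets_gradient:
  "sets gradient_algebra = sigma_sets UNIV {{h. h y - h z \<in> B} | y z B. True}"
  by (simp add: gradient_algebra_def)

lemma measurable_difference [measurable]:
  "(\<lambda>h. h y - h z) \<in> measurable gradient_algebra (count_space UNIV)"
proof (rule measurableI)
  fix A :: "int set"
  have "{h :: 'a \<Rightarrow> int. h y - h z \<in> A} \<in> sets gradient_algebra"
    unfolding sets_gradient by (rule sigma_sets.Basic) blast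
  then show "(\<lambda>h. h y - h z) -` A \<inter> space gradient_algebra \<in> sets (gradient_algebra :: ('a \<Rightarrow> int) measure)"
    by (simp add: vimage_def)
qed simp

lemma measurable_int_add:
  fixes f g :: "'a \<Rightarrow> int"
  assumes "f \<in> measurable N (count_space UNIV)" and "g \<in> measurable N (count_space UNIV)"
  shows "(\<lambda>x. f x + g x) \<in> measurable N (count_space UNIV)"
proof (rule measurable_compose_countable[OF _ assms(1), of "\<lambda>i x. i + g x"])
  fix i
  show "(\<lambda>x. i + g x) \<in> measurable N (count_space UNIV)"
    by (rule measurable_compose[OF assms(2)]) simp
qed

lemma measurable_into_gradient:
  fixes f :: "'w \<Rightarrow> 'v \<Rightarrow> int"
  assumes "\<And>y z. (\<lambda>w. f w y - f w z) \<in> measurable N (count_space UNIV)"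
  shows "f \<in> measurable N gradient_algebra"
  unfolding gradient_algebra_def
proof (rule measurable_sigma_sets[OF sets_measure_of])
  fix A :: "('v \<Rightarrow> int) set" assume "A \<in> {{h. h y - h z \<in> B} | y z B. True}"
  then obtain y z B where A: "A = {h. h y - h z \<in> B}" by blast
  have "(\<lambda>w. f w y - f w z) -` B \<inter> space N \<in> sets N"
    using assms by (rule measurable_sets) simp
  then show "f -` A \<inter> space N \<in> sets N"
    by (simp add: A vimage_def)
qed auto

lemma measurable_translate [measurable]: "translate d \<in> measurable gradient_algebra gradient_algebra"
proof (rule measurable_into_gradient)
  fix y z
  have "(\<lambda>w. translate d w y - translate d w z) = (\<lambda>i. i + (d y - d z)) \<circ> (\<lambda>h. h y - h z)"
    by (auto simp: translate_def)
  then show "(\<lambda>w. translate d w y - translate d w z) \<in> measurable gradient_algebra (count_space UNIV)"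
    by (simp only:) (rule measurable_comp[OF measurable_difference], simp)
qed

lemma translate_vimage_sets [measurable (raw)]:
  assumes "A \<in> sets gradient_algebra"
  shows "translate d -` A \<in> sets gradient_algebra"
  using measurable_sets[OF measurable_translate assms] by simp

subsection \<open>Trees as parent maps\<close>

text \<open>With one parent per vertex, connectedness amounts to common ancestors and the absence of
  cycles to iterates of \<open>p\<close> that never return.\<close>

locale parent_map =
  fixes p :: "'v::countable \<Rightarrow> 'v"
  assumes acyclic: "(p ^^ n) x = x \<Longrightarrow> n = 0"
    and common_ancestor: "\<exists>m n. (p ^^ m) x = (p ^^ n) y"
    and child: "\<exists>y. p y = x"

text \<open>A periodic orbit of \<open>p\<close> with least period at least 3 is an undirected
  cycle; periods 1 and 2 contradict the orientation. A common ancestor is carried along an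
  undirected path, since each step up or down only lengthens one of the two ascents.\<close>

lemma tree_parent_map:
  fixes p :: "'v::countable \<Rightarrow> 'v"
  assumes "directed_tree (range (\<lambda>x. (x, p x)))" and ch: "\<And>x. \<exists>y. p y = x"
  shows "parent_map p"
proof
  let ?E = "range (\<lambda>x. (x, p x))"
  interpret directed_tree ?E by fact
  have adj: "adjacent ?E x y \<longleftrightarrow> p x = y \<or> p y = x" for x y
    by (auto simp: adjacent_def)
  fix x
  show "n = 0" if "(p ^^ n) x = x" for n
  proof (rule ccontr)
    assume "n \<noteq> 0"
    define m where "m = (LEAST m. m > 0 \<and> (p ^^ m) x = x)"
    have m: "m > 0" "(p ^^ m) x = x"
      using LeastI[of "\<lambda>m. m > 0 \<and> (p ^^ m) x = x" n] \<open>n \<noteq> 0\<close> that by (auto simp: m_def)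
    have least: "m \<le> k" if "k > 0" "(p ^^ k) x = x" for k
      unfolding m_def using that by (intro Least_le) auto
    have "m \<noteq> 1"
      using m oriented[of x x] by (auto simp: image_iff)
    moreover have "m \<noteq> 2"
    proof
      assume "m = 2"
      with m have "p (p x) = x" by (simp add: numeral_2_eq_2)
      then show False using oriented[of x "p x"] by (auto intro: rev_image_eqI[of "p x"])
    qed
    ultimately have "m \<ge> 3" using m by linarith
    define xs where "xs = map (\<lambda>k. (p ^^ k) x) [0..<m]"
    have inj: "i = j" if "i \<le> j" "j < m" "(p ^^ i) x = (p ^^ j) x" for i j
    proof (rule ccontr)
      assume "i \<noteq> j"
      have "(p ^^ (m - j + i)) x = (p ^^ (m - j)) ((p ^^ j) x)"
        by (simp only: funpow_add comp_apply that(3))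
      also have "\<dots> = (p ^^ (m - j + j)) x"
        by (simp only: funpow_add comp_apply)
      also have "\<dots> = x" using that m by simp
      finally have "m \<le> m - j + i" using that by (intro least) auto
      with that \<open>i \<noteq> j\<close> show False by linarith
    qed
    have "distinct xs"
      unfolding xs_def distinct_map
      by (auto intro!: inj_onI) (metis inj nat_le_linear)
    moreover have "successively (adjacent ?E) xs"
      unfolding successively_conv_nth by (auto simp: xs_def adj)
    moreover have "adjacent ?E (last xs) (hd xs)"
    proof -
      have "last xs = (p ^^ (m - 1)) x" "hd xs = x"
        using m by (auto simp: xs_def last_map hd_map)
      moreover have "p ((p ^^ (m - 1)) x) = x"
        using m by (metis Suc_pred' comp_apply funpow.simps(2))
      ultimately show ?thesis by (simp add: adj)
    qed
    ultimately show False
      using no_cycle[of xs] \<open>m \<ge> 3\<close> by (auto simp: undirected_cycle_def xs_def)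
  qed
  fix y
  from connected[of x y] show "\<exists>m n. (p ^^ m) x = (p ^^ n) y"
  proof (induction rule: rtranclp_induct)
    case base
    then show ?case by blast
  next
    case (step y z)
    then obtain m n where mn: "(p ^^ m) x = (p ^^ n) y" by blast
    from step consider "p y = z" | "p z = y" by (auto simp: adj)
    then show ?case
    proof cases
      case 1
      then have "(p ^^ Suc m) x = (p ^^ n) z"
        using mn by (metis comp_apply funpow.simps(2) funpow_swap1)
      then show ?thesis by blast
    next
      case 2
      then have "(p ^^ m) x = (p ^^ Suc n) z"
        using mn by (metis comp_apply funpow.simps(2) funpow_swap1)
      then show ?thesis by blast
    qed
  qed
  show "\<exists>y. p y = x" by (rule ch)
qed

context parent_map
begin

abbreviation edges :: "('v \<times> 'v) set" where
  "edges \<equiv> range (\<lambda>x. (x, p x))"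

definition incr :: "('v \<Rightarrow> int) \<Rightarrow> 'v \<Rightarrow> int" where
  "incr h x = h (p x) - h x"

abbreviation M :: "('v \<Rightarrow> int) set" where
  "M \<equiv> Mon edges"

lemma M_iff: "h \<in> M \<longleftrightarrow> (\<forall>x. 0 \<le> incr h x)"
  by (auto simp: Mon_def incr_def)

lemma M_le: "h \<in> M \<Longrightarrow> h x \<le> h (p x)"
  by (auto simp: M_iff incr_def dest: spec[of _ x])

lemma M_le_funpow: "h \<in> M \<Longrightarrow> h x \<le> h ((p ^^ n) x)"
  by (induction n) (auto intro: order_trans M_le)

lemma measurable_incr [measurable]: "(\<lambda>h. incr h x) \<in> measurable gradient_algebra (count_space UNIV)"
  unfolding incr_def by measurable

lemma M_sets [measurable]: "M \<in> sets gradient_algebra"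
proof -
  have "M = {h \<in> space gradient_algebra. \<forall>x. 0 \<le> incr h x}"
    by (auto simp: M_iff)
  also have "\<dots> \<in> sets gradient_algebra" by measurable
  finally show ?thesis .
qed

lemma funpow_inj: "(p ^^ m) x = (p ^^ n) x \<Longrightarrow> m = n"
proof (induction m n rule: linorder_wlog)
  case (le m n)
  have "(p ^^ (n - m)) ((p ^^ m) x) = (p ^^ m) x"
    using le by (metis comp_apply funpow_add le_add_diff_inverse2)
  then show ?case using acyclic le(1) by fastforce
qed simp

subsection \<open>Cylinder sets of increments\<close>

text \<open>Lower bounds are preferred to exact values because they are stable under intersection
  and a shift of an increment is a shift of its bound. The base \<open>J\<close> may be infinite, as
  for the set of all children of a vertex.\<close>

definition cyl :: "'v set \<Rightarrow> ('v \<Rightarrow> int) \<Rightarrow> ('v \<Rightarrow> int) set" where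
  "cyl J k = {h. \<forall>x\<in>J. k x \<le> incr h x}"

lemma cyl_sets [measurable]: "cyl J k \<in> sets gradient_algebra"
proof -
  have "cyl J k = {h \<in> space gradient_algebra. \<forall>x. x \<in> J \<longrightarrow> k x \<le> incr h x}"
    by (auto simp: cyl_def)
  also have "\<dots> \<in> sets gradient_algebra" by measurable
  finally show ?thesis .
qed

abbreviation cyls :: "('v \<Rightarrow> int) set set" where
  "cyls \<equiv> {cyl J k | J k. finite J}"

lemma Int_stable_cyls: "Int_stable cyls"
proof (rule Int_stableI)
  fix a b assume "a \<in> cyls" "b \<in> cyls"
  then obtain J k J' k' where ab: "a = cyl J k" "b = cyl J' k'" "finite J" "finite J'" by blast
  have "a \<inter> b = cyl (J \<union> J') (\<lambda>x. if x \<in> J \<and> x \<in> J' then max (k x) (k' x) else if x \<in> J then k x else k' x)"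
    unfolding ab cyl_def by (auto split: if_splits)
  then show "a \<inter> b \<in> cyls" using ab by blast
qed

text \<open>Any height difference is a finite signed sum of increments along the two ascents to a
  common ancestor.\<close>

lemma measurable_differences_from_incr:
  assumes [measurable]: "\<And>x. (\<lambda>w. incr (f w) x) \<in> measurable N (count_space UNIV)"
  shows "f \<in> measurable N gradient_algebra"
proof (rule measurable_into_gradient)
  have up: "(\<lambda>w. f w ((p ^^ n) x) - f w x) \<in> measurable N (count_space UNIV)" for n x
  proof (induction n)
    case (Suc n)
    have "(\<lambda>w. f w ((p ^^ Suc n) x) - f w x)
        = (\<lambda>w. incr (f w) ((p ^^ n) x) + (f w ((p ^^ n) x) - f w x))"
      by (auto simp: incr_def)
    also have "\<dots> \<in> measurable N (count_space UNIV)"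
      using Suc by (intro measurable_int_add) auto
    finally show ?case .
  qed simp
  fix y z
  obtain m n where "(p ^^ m) y = (p ^^ n) z" using common_ancestor by blast
  then have "(\<lambda>w. f w y - f w z) =
      (\<lambda>w. - (f w ((p ^^ m) y) - f w y) + (f w ((p ^^ n) z) - f w z))"
    by auto
  also have "\<dots> \<in> measurable N (count_space UNIV)"
    by (intro measurable_int_add up measurable_compose[OF up, of uminus]) simp
  finally show "(\<lambda>w. f w y - f w z) \<in> measurable N (count_space UNIV)" .
qed

lemma sets_gradient_cyls: "sets gradient_algebra = sigma_sets UNIV cyls"
proof
  let ?N = "sigma UNIV cyls"
  have [simp]: "space ?N = UNIV" "sets ?N = sigma_sets UNIV cyls"
    by (simp_all add: space_measure_of_conv)
  have in_N: "cyl {x} k \<in> sets ?N" for x k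
    by (auto intro!: sigma_sets.Basic)
  have "id \<in> measurable ?N gradient_algebra"
  proof (rule measurable_differences_from_incr)
    fix x
    have "{h. incr h x = k} \<in> sets ?N" for k
    proof -
      have "{h. incr h x = k} = cyl {x} (\<lambda>_. k) - cyl {x} (\<lambda>_. k + 1)"
        by (auto simp: cyl_def)
      then show ?thesis by (simp only:) (intro sets.Diff in_N)
    qed
    then show "(\<lambda>w. incr (id w) x) \<in> measurable ?N (count_space UNIV)"
      by (subst measurable_count_space_eq2_countable) (auto simp: vimage_def)
  qed
  then show "sets gradient_algebra \<subseteq> sigma_sets UNIV cyls"
    using measurable_sets[of id ?N gradient_algebra] by fastforce
  show "sigma_sets UNIV cyls \<subseteq> sets gradient_algebra"
    using sets.sigma_sets_subset[of cyls "gradient_algebra :: ('v \<Rightarrow> int) measure"] cyl_sets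
    unfolding space_gradient by blast
qed

lemma measure_eqI_cyl:
  assumes "sets \<mu> = sets gradient_algebra" "sets \<nu> = sets gradient_algebra"
    and "finite_measure \<mu>"
    and eq: "\<And>J k. finite J \<Longrightarrow> emeasure \<mu> (cyl J k) = emeasure \<nu> (cyl J k)"
  shows "\<mu> = \<nu>"
\<comment> \<open>A cylinder with empty base is the whole space, so the exhausting sequence can be
  constant.\<close>
proof (rule measure_eqI_generator_eq[OF Int_stable_cyls, where \<Omega> = UNIV and A = "\<lambda>_. cyl {} (\<lambda>_. 0)"])
  interpret finite_measure \<mu> by fact
  show "emeasure \<mu> (cyl {} (\<lambda>_. 0)) \<noteq> \<infinity>" by simp
qed (use assms in \<open>auto simp: sets_gradient_cyls, auto simp: cyl_def\<close>)


subsection \<open>Gibbs measures as measures invariant under finite modifications\<close>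

lemma funpow_escapes:
  assumes "finite \<Lambda>"
  shows "\<exists>n. (p ^^ n) x \<notin> \<Lambda>"
proof (rule ccontr)
  assume "\<not> ?thesis"
  then have "range (\<lambda>n. (p ^^ n) x) \<subseteq> \<Lambda>" by auto
  moreover have "inj (\<lambda>n. (p ^^ n) x)"
    by (auto intro: injI funpow_inj)
  ultimately show False
    using assms finite_subset range_inj_infinite by blast
qed

text \<open>Choosing a child again and again gives an infinite descending line, which cannot repeat
  a vertex. This is how the existence of children bounds heights from below.\<close>

lemma descendant_escapes:
  assumes "finite \<Lambda>"
  shows "\<exists>y n. (p ^^ n) y = x \<and> y \<notin> \<Lambda>"
proof (rule ccontr)
  assume *: "\<not> ?thesis"
  obtain c where c: "p (c y) = y" for y using child by metis
  have pc: "(p ^^ n) ((c ^^ n) y) = y" for n y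
    by (induction n arbitrary: y) (simp_all add: funpow_swap1 c)
  have "range (\<lambda>n. (c ^^ n) x) \<subseteq> \<Lambda>" using * pc by blast
  moreover have "inj (\<lambda>n. (c ^^ n) x)"
  proof (rule linorder_injI)
    fix m n :: nat assume "m < n"
    show "(c ^^ m) x \<noteq> (c ^^ n) x"
    proof
      assume "(c ^^ m) x = (c ^^ n) x"
      then have "x = (p ^^ m) ((c ^^ m) ((c ^^ (n - m)) x))"
        using pc[of m x] \<open>m < n\<close> by (simp flip: funpow_add[unfolded o_def, THEN fun_cong])
      then have "x = (c ^^ (n - m)) x" by (simp add: pc)
      then have "(p ^^ (n - m)) x = x" using pc[of "n - m" x] by metis
      then show False using acyclic \<open>m < n\<close> by fastforce
    qed
  qed
  ultimately show False
    using assms finite_subset range_inj_infinite by blast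
qed

text \<open>At each vertex of \<open>\<Lambda>\<close> monotonicity squeezes \<open>h\<close>
  between the values of \<open>b\<close> at a descendant and at an ancestor outside
  \<open>\<Lambda>\<close>. Cutting \<open>h\<close> to 0 outside \<open>\<Lambda>\<close> loses
  nothing, since the values there are prescribed.\<close>

lemma finite_fibre:
  assumes "finite \<Lambda>"
  shows "finite {h \<in> M. \<forall>v. v \<notin> \<Lambda> \<longrightarrow> h v = b v}"
proof -
  obtain n where n: "(p ^^ n x) x \<notin> \<Lambda>" for x
    using funpow_escapes[OF assms] by metis
  obtain y m where y: "(p ^^ m x) (y x) = x" "y x \<notin> \<Lambda>" for x
    using descendant_escapes[OF assms] by metis
  let ?B = "{h. \<forall>v. (v \<in> \<Lambda> \<longrightarrow> h v \<in> (\<Union>x\<in>\<Lambda>. {b (y x)..b ((p ^^ n x) x)})) \<and> (v \<notin> \<Lambda> \<longrightarrow> h v = 0)}"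
  let ?r = "\<lambda>h v. if v \<in> \<Lambda> then h v else 0"
  have "finite ?B"
    using assms by (intro finite_set_of_finite_funs) auto
  moreover have "?r ` {h \<in> M. \<forall>v. v \<notin> \<Lambda> \<longrightarrow> h v = b v} \<subseteq> ?B"
  proof clarsimp
    fix h v assume h: "h \<in> M" "\<forall>v. v \<notin> \<Lambda> \<longrightarrow> h v = b v" and "v \<in> \<Lambda>"
    have "h (y v) \<le> h v" "h v \<le> h ((p ^^ n v) v)"
      using M_le_funpow[OF h(1), of "y v" "m v"] M_le_funpow[OF h(1), of v "n v"] y(1)[of v] by simp_all
    then show "\<exists>x\<in>\<Lambda>. b (y x) \<le> h v \<and> h v \<le> b ((p ^^ n x) x)"
      using h n y \<open>v \<in> \<Lambda>\<close> by metis
  qed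
  ultimately have "finite (?r ` {h \<in> M. \<forall>v. v \<notin> \<Lambda> \<longrightarrow> h v = b v})"
    by (rule finite_subset[rotated])
  moreover have "inj_on ?r {h \<in> M. \<forall>v. v \<notin> \<Lambda> \<longrightarrow> h v = b v}"
  proof (rule inj_onI, rule ext)
    fix h h' v
    assume "h \<in> {h \<in> M. \<forall>v. v \<notin> \<Lambda> \<longrightarrow> h v = b v}" "h' \<in> {h \<in> M. \<forall>v. v \<notin> \<Lambda> \<longrightarrow> h v = b v}" "?r h = ?r h'"
    then show "h v = h' v"
      by (cases "v \<in> \<Lambda>") (auto dest: fun_cong[of _ _ v])
  qed
  ultimately show ?thesis by (rule finite_imageD)
qed

text \<open>Both \<open>A\<close> and its preimage are required to lie in \<open>M\<close>, because
  a uniform measure on a fibre compares monotone configurations only.\<close>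

definition invar :: "('v \<Rightarrow> int) measure \<Rightarrow> ('v \<Rightarrow> int) \<Rightarrow> bool" where
  "invar \<mu> d \<longleftrightarrow> (\<forall>A\<in>sets gradient_algebra. A \<subseteq> M \<longrightarrow> translate d -` A \<subseteq> M \<longrightarrow>
     emeasure \<mu> (translate d -` A) = emeasure \<mu> A)"

lemma invarD:
  "invar \<mu> d \<Longrightarrow> A \<in> sets gradient_algebra \<Longrightarrow> A \<subseteq> M \<Longrightarrow> translate d -` A \<subseteq> M \<Longrightarrow>
    emeasure \<mu> (translate d -` A) = emeasure \<mu> A"
  by (auto simp: invar_def)

lemma gibbs_kernel_emeasure:
  assumes "finite \<Lambda>" "b \<in> M"
  shows "emeasure (measure_pmf (gibbs_kernel edges \<Lambda> b)) A =
    card (A \<inter> {h \<in> M. \<forall>v. v \<notin> \<Lambda> \<longrightarrow> h v = b v}) / card {h \<in> M. \<forall>v. v \<notin> \<Lambda> \<longrightarrow> h v = b v}"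
proof -
  have "b \<in> {h \<in> M. \<forall>v. v \<notin> \<Lambda> \<longrightarrow> h v = b v}" using assms by auto
  then show ?thesis
    unfolding gibbs_kernel_def
    by (subst emeasure_pmf_of_set) (use assms finite_fibre in \<open>auto simp: Int_commute\<close>)
qed

text \<open>With \<open>\<Lambda>\<close> the support of \<open>d\<close>, translation maps the
  preimage of \<open>A\<close> bijectively onto \<open>A\<close> within every fibre, so the kernels
  already give both events the same probability before integration.\<close>

lemma gradient_gibbs_invar:
  assumes gibbs: "gradient_gibbs edges \<mu>" and fin: "finite {v. d v \<noteq> 0}"
  shows "invar \<mu> d"
  unfolding invar_def
proof (intro ballI impI)
  fix A :: "('v \<Rightarrow> int) set"
  assume A: "A \<in> sets gradient_algebra" "A \<subseteq> M" "translate d -` A \<subseteq> M"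
  let ?\<Lambda> = "{v. d v \<noteq> 0}"
  have eq: "emeasure (measure_pmf (gibbs_kernel edges ?\<Lambda> b)) (translate d -` A) =
      emeasure (measure_pmf (gibbs_kernel edges ?\<Lambda> b)) A" if "b \<in> M" for b
  proof -
    let ?F = "{h \<in> M. \<forall>v. v \<notin> ?\<Lambda> \<longrightarrow> h v = b v}"
    have "A \<inter> ?F = translate d ` (translate d -` A \<inter> ?F)"
    proof (intro equalityI subsetI)
      fix h assume h: "h \<in> A \<inter> ?F"
      let ?g = "translate (\<lambda>v. - d v) h"
      have "?g \<in> translate d -` A" using h by simp
      then have "?g \<in> translate d -` A \<inter> ?F"
        using h A by (auto simp: translate_def)
      moreover have "h = translate d ?g" by simp
      ultimately show "h \<in> translate d ` (translate d -` A \<inter> ?F)" by blast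
    next
      fix h assume "h \<in> translate d ` (translate d -` A \<inter> ?F)"
      then show "h \<in> A \<inter> ?F" using A by (auto simp: translate_def)
    qed
    moreover have "inj_on (translate d) (translate d -` A \<inter> ?F)"
      by (rule inj_onI) (auto simp: translate_def fun_eq_iff)
    ultimately have "card (A \<inter> ?F) = card (translate d -` A \<inter> ?F)"
      using card_image by fastforce
    then show ?thesis
      using that fin by (simp add: gibbs_kernel_emeasure)
  qed
  have *: "emeasure \<mu> B = (\<integral>\<^sup>+b\<in>M. emeasure (measure_pmf (gibbs_kernel edges ?\<Lambda> b)) B \<partial>\<mu>)"
    if "B \<in> sets gradient_algebra" for B
    using gibbs fin that by (simp add: gradient_gibbs_def)
  show "emeasure \<mu> (translate d -` A) = emeasure \<mu> A"
    unfolding *[OF A(1)] *[OF translate_vimage_sets[OF A(1)]]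
    by (intro nn_integral_cong) (auto simp: eq indicator_def)
qed

text \<open>This is the change of variables behind \<open>invar\<close>, on the part of
  \<open>M\<close> that the translation keeps in \<open>M\<close>. The form with a function is
  needed for the weights 1 / (size of the fibre).\<close>

lemma invar_nn_integral:
  assumes [simp]: "sets \<mu> = sets gradient_algebra" and inv: "invar \<mu> d"
    and [measurable]: "g \<in> borel_measurable gradient_algebra"
  shows "(\<integral>\<^sup>+h. indicator M h * indicator M (translate d h) * g (translate d h) \<partial>\<mu>) =
    (\<integral>\<^sup>+h. indicator M h * indicator M (translate (\<lambda>v. - d v) h) * g h \<partial>\<mu>)"
proof -
  have [measurable_cong]: "sets \<mu> = sets gradient_algebra" by simp
  have space [simp]: "space \<mu> = UNIV" using sets_eq_imp_space_eq[of \<mu> gradient_algebra] by simp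
  have [measurable]: "M \<in> sets \<mu>" by simp
  have [measurable]: "translate d -` M \<in> sets \<mu>" for d using M_sets by (simp add: translate_vimage_sets)
  let ?A = "M \<inter> translate d -` M" and ?B = "M \<inter> translate (\<lambda>v. - d v) -` M"
  have eq: "distr (density \<mu> (indicator ?A)) gradient_algebra (translate d) = density \<mu> (indicator ?B)"
  proof (rule measure_eqI)
    fix C assume "C \<in> sets (distr (density \<mu> (indicator ?A)) gradient_algebra (translate d))"
    then have C: "C \<in> sets gradient_algebra" by simp
    have [measurable]: "C \<in> sets \<mu>" "translate d -` C \<in> sets \<mu>" using C by (simp_all add: translate_vimage_sets)
    have "emeasure (distr (density \<mu> (indicator ?A)) gradient_algebra (translate d)) C
        = emeasure \<mu> (?A \<inter> translate d -` C)"
      using C by (subst emeasure_distr) (auto simp: emeasure_restricted translate_vimage_sets)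
    also have "?A \<inter> translate d -` C = translate d -` (?B \<inter> C)"
      by auto
    also have "emeasure \<mu> (translate d -` (?B \<inter> C)) = emeasure \<mu> (?B \<inter> C)"
      using C by (intro invarD[OF inv] sets.Int translate_vimage_sets M_sets) auto
    also have "\<dots> = emeasure (density \<mu> (indicator ?B)) C"
      using C by (subst emeasure_restricted) (auto simp: translate_vimage_sets)
    finally show "emeasure (distr (density \<mu> (indicator ?A)) gradient_algebra (translate d)) C
        = emeasure (density \<mu> (indicator ?B)) C" .
  qed simp
  have "(\<integral>\<^sup>+h. indicator M h * indicator M (translate d h) * g (translate d h) \<partial>\<mu>)
      = (\<integral>\<^sup>+h. indicator ?A h * g (translate d h) \<partial>\<mu>)"
    by (intro nn_integral_cong) (auto simp: indicator_def)
  also have "\<dots> = (\<integral>\<^sup>+h. g h \<partial>distr (density \<mu> (indicator ?A)) gradient_algebra (translate d))"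
    by (subst nn_integral_distr) (auto simp: nn_integral_density)
  also have "\<dots> = (\<integral>\<^sup>+h. indicator ?B h * g h \<partial>\<mu>)"
    unfolding eq by (subst nn_integral_density) auto
  also have "\<dots> = (\<integral>\<^sup>+h. indicator M h * indicator M (translate (\<lambda>v. - d v) h) * g h \<partial>\<mu>)"
    by (intro nn_integral_cong) (auto simp: indicator_def)
  finally show ?thesis .
qed

text \<open>A mass transport argument: the kernel is a sum over all \<open>d\<close> supported in
  \<open>\<Lambda>\<close> of the mass that \<open>b\<close> sends to \<open>translate d b\<close>.
  Moving each summand by invariance turns mass sent into mass received, and each \<open>h\<close>
  receives in total \<open>indicator A h\<close>.\<close>

lemma invar_gradient_gibbs:
  assumes "prob_space \<mu>" and sets [simp]: "sets \<mu> = sets gradient_algebra"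
    and AE: "AE h in \<mu>. h \<in> M"
    and inv: "\<And>d. finite {v. d v \<noteq> 0} \<Longrightarrow> invar \<mu> d"
  shows "gradient_gibbs edges \<mu>"
  unfolding gradient_gibbs_def
proof (intro conjI allI impI ballI)
  show space: "space \<mu> = UNIV" using sets_eq_imp_space_eq[OF sets] by simp
  have [measurable_cong]: "sets \<mu> = sets gradient_algebra" by simp
  fix \<Lambda> :: "'v set" and A :: "('v \<Rightarrow> int) set"
  assume fin: "finite \<Lambda>" and A [measurable]: "A \<in> sets gradient_algebra"
  define D where "D = {d :: 'v \<Rightarrow> int. \<forall>v. v \<notin> \<Lambda> \<longrightarrow> d v = 0}"
  have supp: "finite {v. d v \<noteq> 0}" if "d \<in> D" for d
    using that fin by (auto simp: D_def intro: finite_subset)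
  have D: "countable D"
    by (rule countable_subset[OF _ countable_finite_support]) (use supp in blast)
  define F where "F = (\<lambda>b. {h \<in> M. \<forall>v. v \<notin> \<Lambda> \<longrightarrow> h v = b v})"
  \<comment> \<open>The size of the fibre, written as a sum over \<open>D\<close> so that its
    measurability can be read off.\<close>
  define N where "N = (\<lambda>b. \<integral>\<^sup>+d. indicator M (translate d b) \<partial>count_space D)"
  have card_F: "(\<integral>\<^sup>+d. indicator (M \<inter> B) (translate d b) \<partial>count_space D) = card (B \<inter> F b)" for B b
  proof -
    have inj: "inj_on (\<lambda>d. translate d b) X" for X
      by (rule inj_onI) (auto simp: translate_def fun_eq_iff)
    have im: "(\<lambda>d. translate d b) ` {d \<in> D. translate d b \<in> M \<inter> B} = B \<inter> F b"
    proof (intro equalityI subsetI)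
      fix h assume h: "h \<in> B \<inter> F b"
      let ?d = "\<lambda>v. h v - b v"
      have "h = translate ?d b" "?d \<in> D" using h by (auto simp: translate_def D_def F_def)
      then show "h \<in> (\<lambda>d. translate d b) ` {d \<in> D. translate d b \<in> M \<inter> B}" 
        using h by (intro image_eqI[of _ _ ?d]) (auto simp: F_def)
    qed (auto simp: F_def D_def translate_def)
    have finite: "finite {d \<in> D. translate d b \<in> M \<inter> B}"
      using inj by (rule finite_imageD[rotated]) (use finite_fibre[OF fin] im in \<open>auto simp: F_def\<close>)
    have "(\<integral>\<^sup>+d. indicator (M \<inter> B) (translate d b) \<partial>count_space D)
        = (\<integral>\<^sup>+d. indicator {d \<in> D. translate d b \<in> M \<inter> B} d \<partial>count_space D)"
      by (intro nn_integral_cong) (auto simp: indicator_def)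
    also have "\<dots> = emeasure (count_space D) {d \<in> D. translate d b \<in> M \<inter> B}"
      by (intro nn_integral_indicator) auto
    also have "\<dots> = card {d \<in> D. translate d b \<in> M \<inter> B}"
      using finite by (subst emeasure_count_space) auto
    also have "\<dots> = card (B \<inter> F b)"
      by (simp only: card_image[OF inj] flip: im)
    finally show ?thesis .
  qed
  have N_card: "N b = card (F b)" for b
    using card_F[of UNIV b] by (simp add: N_def)
  have N_pos: "N b \<noteq> 0" "N b \<noteq> \<infinity>" if "b \<in> M" for b
  proof -
    have "b \<in> F b" "finite (F b)" using that finite_fibre[OF fin] by (auto simp: F_def)
    then show "N b \<noteq> 0" "N b \<noteq> \<infinity>" by (auto simp: N_card)
  qed
  have N_translate: "N (translate d b) = N b" if "d \<in> D" for d b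
    using that by (simp add: N_card F_def D_def translate_def)
  have [measurable]: "M \<in> sets \<mu>" by simp
  have sM [measurable]: "(\<lambda>h. indicator M (translate d h) :: ennreal) \<in> borel_measurable gradient_algebra" for d
    using measurable_compose[OF measurable_translate, of "indicator M" borel] by simp
  have [measurable]: "N \<in> borel_measurable gradient_algebra"
  proof -
    interpret sigma_finite_measure "count_space D"
      using D by (rule sigma_finite_measure_count_space_countable)
    have "(\<lambda>(d, b). indicator M (translate d b) :: ennreal) \<in> borel_measurable (count_space D \<Otimes>\<^sub>M gradient_algebra)"
      by (intro measurable_pair_measure_countable1 D) (simp, measurable)
    then show ?thesis
      unfolding N_def
      by (intro borel_measurable_nn_integral) (subst measurable_pair_swap_iff, simp add: case_prod_beta)
  qed
  \<comment> \<open>Dividing by \<open>N\<close> at the target instead of the source is allowed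
    because \<open>N\<close> is constant along a fibre.\<close>
  define g where "g = (\<lambda>h. indicator A h / N h)"
  have [measurable]: "g \<in> borel_measurable gradient_algebra" by (simp add: g_def)
  have sg [measurable]: "(\<lambda>h. g (translate d h)) \<in> borel_measurable gradient_algebra" for d
    by (rule measurable_compose[OF measurable_translate]) measurable
  have "(\<integral>\<^sup>+b\<in>M. emeasure (measure_pmf (gibbs_kernel edges \<Lambda> b)) A \<partial>\<mu>)
      = (\<integral>\<^sup>+b. \<integral>\<^sup>+d. indicator M b * indicator M (translate d b) * g (translate d b) \<partial>count_space D \<partial>\<mu>)"
  proof (intro nn_integral_cong)
    fix b
    show "emeasure (measure_pmf (gibbs_kernel edges \<Lambda> b)) A * indicator M b
      = (\<integral>\<^sup>+d. indicator M b * indicator M (translate d b) * g (translate d b) \<partial>count_space D)"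
    proof (cases "b \<in> M")
      case True
      have "emeasure (measure_pmf (gibbs_kernel edges \<Lambda> b)) A = card (A \<inter> F b) / real (card (F b))"
        using True fin by (simp add: gibbs_kernel_emeasure F_def)
      also have "\<dots> = (\<integral>\<^sup>+d. indicator (M \<inter> A) (translate d b) \<partial>count_space D) / N b"
        using N_pos[OF True] unfolding card_F N_card
        by (subst divide_ennreal[symmetric]) (auto simp: ennreal_of_nat_eq_real_of_nat)
      also have "\<dots> = (\<integral>\<^sup>+d. indicator M b * indicator M (translate d b) * g (translate d b) \<partial>count_space D)"
        using True
        by (subst nn_integral_divide[symmetric])
           (auto intro!: nn_integral_cong simp: g_def N_translate indicator_def)
      finally show ?thesis using True by simp
    qed simp
  qed
  also have "\<dots> = (\<integral>\<^sup>+d. \<integral>\<^sup>+b. indicator M b * indicator M (translate d b) * g (translate d b) \<partial>\<mu> \<partial>count_space D)"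
    by (intro nn_integral_count_space_nn_integral D) measurable
  also have "\<dots> = (\<integral>\<^sup>+d. \<integral>\<^sup>+b. indicator M b * indicator M (translate (\<lambda>v. - d v) b) * g b \<partial>\<mu> \<partial>count_space D)"
    by (intro nn_integral_cong invar_nn_integral inv supp) auto
  also have "\<dots> = (\<integral>\<^sup>+b. \<integral>\<^sup>+d. indicator M b * indicator M (translate (\<lambda>v. - d v) b) * g b \<partial>count_space D \<partial>\<mu>)"
    by (intro nn_integral_count_space_nn_integral[symmetric] D) measurable
  also have "\<dots> = (\<integral>\<^sup>+b. indicator A b \<partial>\<mu>)"
  proof (intro nn_integral_cong_AE, use AE in eventually_elim)
    fix b assume b: "b \<in> M"
    have "(\<integral>\<^sup>+d. indicator M b * indicator M (translate (\<lambda>v. - d v) b) * g b \<partial>count_space D)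
        = (\<integral>\<^sup>+d. indicator M (translate (\<lambda>v. - d v) b) \<partial>count_space D) * g b"
      using b by (subst nn_integral_multc[symmetric]) auto
    \<comment> \<open>Negation permutes \<open>D\<close>, so counting the sources of
      \<open>b\<close> counts its fibre again.\<close>
    also have "(\<integral>\<^sup>+d. indicator M (translate (\<lambda>v. - d v) b) \<partial>count_space D) = N b"
      unfolding N_def
      by (rule nn_integral_bij_count_space[where g = "\<lambda>d v. - d v"])
         (auto simp: D_def intro!: bij_betw_byWitness[where f' = "\<lambda>d v. - d v"])
    also have "N b * g b = indicator A b"
      using N_pos[OF b] by (simp add: g_def ennreal_times_divide mult.commute[of "N b"] ennreal_mult_divide_eq)
    finally show "(\<integral>\<^sup>+d. indicator M b * indicator M (translate (\<lambda>v. - d v) b) * g b \<partial>count_space D) = indicator A b" .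
  qed
  also have "\<dots> = emeasure \<mu> A" by simp
  finally show "(\<integral>\<^sup>+b\<in>M. emeasure (measure_pmf (gibbs_kernel edges \<Lambda> b)) A \<partial>\<mu>) = emeasure \<mu> A" .
qed (use assms in auto)

end

subsection \<open>Approximation by local events\<close>

text \<open>A single set \<open>D\<close> must serve both measures, otherwise an inequality known on
  the algebra could not be transferred to \<open>C\<close>.\<close>

lemma algebra_approximation:
  assumes alg: "algebra \<Omega> \<A>" and "finite_measure \<mu>" "finite_measure \<nu>"
    and sets: "sets \<mu> = sigma_sets \<Omega> \<A>" "sets \<nu> = sigma_sets \<Omega> \<A>"
    and "C \<in> sigma_sets \<Omega> \<A>" "0 < e"
  shows "\<exists>D\<in>\<A>. measure \<mu> ((C - D) \<union> (D - C)) + measure \<nu> ((C - D) \<union> (D - C)) < e"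
  using assms(6,7)
proof (induction C arbitrary: e)
  case (Basic a)
  then show ?case by (intro bexI[of _ a]) auto
next
  case Empty
  interpret algebra \<Omega> \<A> by fact
  show ?case using Empty by (intro bexI[of _ "{}"]) auto
next
  case (Compl a)
  interpret algebra \<Omega> \<A> by fact
  from Compl obtain D where D: "D \<in> \<A>" "measure \<mu> ((a - D) \<union> (D - a)) + measure \<nu> ((a - D) \<union> (D - a)) < e"
    by blast
  have "a \<subseteq> \<Omega>" "D \<subseteq> \<Omega>"
    using Compl sigma_sets_into_sp[OF space_closed] D space_closed by auto
  then have "(\<Omega> - a - (\<Omega> - D)) \<union> (\<Omega> - D - (\<Omega> - a)) = (a - D) \<union> (D - a)" by blast
  then show ?case using D by (intro bexI[of _ "\<Omega> - D"]) auto
next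
  case (Union C)
  interpret algebra \<Omega> \<A> by fact
  interpret M: finite_measure \<mu> by fact
  interpret N: finite_measure \<nu> by fact
  have C [measurable]: "C i \<in> sets \<mu>" "C i \<in> sets \<nu>" for i using Union sets by auto
  \<comment> \<open>The errors for the single sets add up to at most e/2; the other half is spent on
    cutting the countable union to a finite one.\<close>
  have "\<exists>D\<in>\<A>. measure \<mu> ((C i - D) \<union> (D - C i)) + measure \<nu> ((C i - D) \<union> (D - C i)) < e / 2 * (1/2) ^ Suc i" for i
    by (rule Union.IH) (use \<open>0 < e\<close> in simp)
  then obtain D where D: "D i \<in> \<A>"
    "measure \<mu> ((C i - D i) \<union> (D i - C i)) + measure \<nu> ((C i - D i) \<union> (D i - C i)) < e / 2 * (1/2) ^ Suc i" for i
    by metis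
  have D_sets [measurable]: "D i \<in> sets \<mu>" "D i \<in> sets \<nu>" for i using D sets by auto
  let ?U = "\<Union>i. C i" and ?V = "\<lambda>n. \<Union>i<n. C i"
  have "(\<lambda>n. measure \<mu> (?U - ?V n) + measure \<nu> (?U - ?V n)) \<longlonglongrightarrow> measure \<mu> (\<Inter>n. ?U - ?V n) + measure \<nu> (\<Inter>n. ?U - ?V n)"
    by (intro tendsto_add M.finite_Lim_measure_decseq N.finite_Lim_measure_decseq)
       (auto simp: decseq_def)
  also have "(\<Inter>n. ?U - ?V n) = {}" by auto
  finally have "eventually (\<lambda>n. measure \<mu> (?U - ?V n) + measure \<nu> (?U - ?V n) < e / 2) sequentially"
    using \<open>0 < e\<close> by (intro order_tendstoD) auto
  then obtain n where n: "measure \<mu> (?U - ?V n) + measure \<nu> (?U - ?V n) < e / 2"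
    by (auto simp: eventually_sequentially)
  let ?D = "\<Union>i<n. D i"
  let ?S = "\<Union>i<n. (C i - D i) \<union> (D i - C i)"
  have bound: "measure K ((?U - ?D) \<union> (?D - ?U))
      \<le> measure K (?U - ?V n) + (\<Sum>i<n. measure K ((C i - D i) \<union> (D i - C i)))"
    if K: "finite_measure K" "\<And>i. C i \<in> sets K" "\<And>i. D i \<in> sets K" for K
  proof -
    interpret K: finite_measure K by fact
    note K(2,3)[measurable]
    have "measure K ((?U - ?D) \<union> (?D - ?U)) \<le> measure K ((?U - ?V n) \<union> ?S)"
      by (intro K.finite_measure_mono) auto
    also have "\<dots> \<le> measure K (?U - ?V n) + measure K ?S"
      by (intro measure_Un_le) auto
    also have "measure K ?S \<le> (\<Sum>i<n. measure K ((C i - D i) \<union> (D i - C i)))"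
      by (intro K.finite_measure_subadditive_finite) auto
    finally show ?thesis by simp
  qed
  have "(\<Sum>i<n. measure \<mu> ((C i - D i) \<union> (D i - C i))) + (\<Sum>i<n. measure \<nu> ((C i - D i) \<union> (D i - C i)))
      \<le> (\<Sum>i<n. e / 2 * (1/2) ^ Suc i)"
    unfolding sum.distrib[symmetric] by (intro sum_mono less_imp_le D)
  also have "\<dots> = e / 2 * (1 - (1/2) ^ n)"
    by (induction n) (auto simp: field_simps)
  also have "\<dots> \<le> e / 2" using \<open>0 < e\<close> by simp
  finally have "measure \<mu> ((?U - ?D) \<union> (?D - ?U)) + measure \<nu> ((?U - ?D) \<union> (?D - ?U)) < e"
    using n bound[OF \<open>finite_measure \<mu>\<close> C(1) D_sets(1)] bound[OF \<open>finite_measure \<nu>\<close> C(2) D_sets(2)]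
    by linarith
  moreover have "?D \<in> \<A>" using D by auto
  ultimately show ?case by blast
qed

lemma measure_le_from_algebra:
  assumes "algebra \<Omega> \<A>" "finite_measure \<mu>" "finite_measure \<nu>"
    and sets: "sets \<mu> = sigma_sets \<Omega> \<A>" "sets \<nu> = sigma_sets \<Omega> \<A>"
    and le: "\<And>D. D \<in> \<A> \<Longrightarrow> measure \<nu> D \<le> measure \<mu> D"
    and C: "C \<in> sigma_sets \<Omega> \<A>"
  shows "measure \<nu> C \<le> measure \<mu> C"
proof (rule field_le_epsilon)
  fix e :: real assume "0 < e"
  then obtain D where D: "D \<in> \<A>"
    and small: "measure \<mu> ((C - D) \<union> (D - C)) + measure \<nu> ((C - D) \<union> (D - C)) < e"
    using algebra_approximation[OF assms(1-5) C] by blast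
  interpret M: finite_measure \<mu> by fact
  interpret N: finite_measure \<nu> by fact
  have [measurable]: "C \<in> sets \<mu>" "D \<in> sets \<mu>" "C \<in> sets \<nu>" "D \<in> sets \<nu>" using C D sets by auto
  have "measure \<nu> C \<le> measure \<nu> (D \<union> ((C - D) \<union> (D - C)))"
    by (intro N.finite_measure_mono) auto
  also have "\<dots> \<le> measure \<nu> D + measure \<nu> ((C - D) \<union> (D - C))"
    by (intro measure_Un_le) auto
  finally have 1: "measure \<nu> C \<le> measure \<nu> D + measure \<nu> ((C - D) \<union> (D - C))" .
  have "measure \<mu> D \<le> measure \<mu> (C \<union> ((C - D) \<union> (D - C)))"
    by (intro M.finite_measure_mono) auto
  also have "\<dots> \<le> measure \<mu> C + measure \<mu> ((C - D) \<union> (D - C))"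
    by (intro measure_Un_le) auto
  finally show "measure \<nu> C \<le> measure \<mu> C + e"
    using 1 le[OF D] small by linarith
qed

text \<open>Membership is decided by finitely many heights, so on such an event an infinite shift
  can be exchanged for a finite one that agrees with it on \<open>J\<close>.\<close>

definition local_sets :: "('v \<Rightarrow> int) set set" where
  "local_sets = {C \<in> sets gradient_algebra. \<exists>J. finite J \<and> (\<forall>h h'. (\<forall>v\<in>J. h v = h' v) \<longrightarrow> h \<in> C \<longrightarrow> h' \<in> C)}"

lemma algebra_local_sets: "algebra UNIV (local_sets :: ('v \<Rightarrow> int) set set)"
  unfolding algebra_iff_Un
proof (intro conjI ballI)
  show "{} \<in> (local_sets :: ('v \<Rightarrow> int) set set)" by (auto simp: local_sets_def)
  fix a :: "('v \<Rightarrow> int) set" assume a: "a \<in> local_sets"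
  then obtain J where J: "finite J" "\<And>h h'. (\<forall>v\<in>J. h v = h' v) \<Longrightarrow> h \<in> a \<Longrightarrow> h' \<in> a"
    by (auto simp: local_sets_def)
  have "h' \<in> UNIV - a" if "\<forall>v\<in>J. h v = h' v" "h \<in> UNIV - a" for h h'
    using J(2)[of h' h] that by auto
  moreover have "UNIV - a \<in> sets gradient_algebra"
    using a sets.compl_sets[of a gradient_algebra] by (auto simp: local_sets_def)
  ultimately show "UNIV - a \<in> local_sets"
    using J(1) unfolding local_sets_def by blast
  fix b :: "('v \<Rightarrow> int) set" assume b: "b \<in> local_sets"
  then obtain K where K: "finite K" "\<And>h h'. (\<forall>v\<in>K. h v = h' v) \<Longrightarrow> h \<in> b \<Longrightarrow> h' \<in> b"
    by (auto simp: local_sets_def)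
  have "h' \<in> a \<union> b" if "\<forall>v\<in>J \<union> K. h v = h' v" "h \<in> a \<union> b" for h h'
    using J(2)[of h h'] K(2)[of h h'] that by auto
  moreover have "a \<union> b \<in> sets gradient_algebra" "finite (J \<union> K)"
    using a b J K by (auto simp: local_sets_def)
  ultimately show "a \<union> b \<in> local_sets"
    unfolding local_sets_def by blast
qed simp

lemma sets_gradient_local: "sets gradient_algebra = sigma_sets UNIV (local_sets :: ('v \<Rightarrow> int) set set)"
proof
  have "{h. h y - h z \<in> B} \<in> (local_sets :: ('v \<Rightarrow> int) set set)" for y z B
  proof -
    have "{h :: 'v \<Rightarrow> int. h y - h z \<in> B} \<in> sets gradient_algebra"
      unfolding sets_gradient by (rule sigma_sets.Basic) blast
    then show ?thesis
      unfolding local_sets_def by (auto intro!: exI[of _ "{y, z}"])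
  qed
  then show "sets gradient_algebra \<subseteq> sigma_sets UNIV (local_sets :: ('v \<Rightarrow> int) set set)"
    unfolding sets_gradient by (intro sigma_sets_mono') blast
  have "(local_sets :: ('v \<Rightarrow> int) set set) \<subseteq> sets gradient_algebra" by (auto simp: local_sets_def)
  then show "sigma_sets UNIV (local_sets :: ('v \<Rightarrow> int) set set) \<subseteq> sets gradient_algebra"
    using sets.sigma_sets_subset[of local_sets "gradient_algebra :: ('v \<Rightarrow> int) measure"] by simp
qed

context parent_map
begin

subsection \<open>Lowering an increment by one\<close>

definition desc :: "'v \<Rightarrow> 'v set" where
  "desc x = {v. \<exists>n. (p ^^ n) v = x}"

definition ray :: "'v \<Rightarrow> 'v \<Rightarrow> int" where
  "ray x v = (if v \<in> desc x then 1 else 0)"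

lemma desc_refl [simp]: "x \<in> desc x"
  by (auto simp: desc_def intro: exI[of _ 0])

lemma parent_not_desc: "p x \<notin> desc x"
proof
  assume "p x \<in> desc x"
  then obtain n where "(p ^^ Suc n) x = x" by (auto simp: desc_def funpow_swap1)
  then show False using acyclic by blast
qed

text \<open>The only edge that leaves the set of descendants of \<open>x\<close> is the one from
  \<open>x\<close> to \<open>p x\<close>; this is why \<open>ray x\<close> changes a single
  increment.\<close>

lemma desc_parent: "p v \<in> desc x \<longleftrightarrow> v \<in> desc x \<and> v \<noteq> x"
proof
  assume *: "p v \<in> desc x"
  then obtain n where "(p ^^ Suc n) v = x" by (auto simp: desc_def funpow_swap1)
  then show "v \<in> desc x \<and> v \<noteq> x" using * parent_not_desc unfolding desc_def by blast
next
  assume "v \<in> desc x \<and> v \<noteq> x"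
  then obtain n where n: "(p ^^ n) v = x" "v \<noteq> x" by (auto simp: desc_def)
  then obtain m where "n = Suc m" by (cases n) auto
  then show "p v \<in> desc x" using n by (auto simp: desc_def funpow_swap1)
qed

lemma incr_translate: "incr (translate d h) y = incr h y + d (p y) - d y"
  by (simp add: incr_def translate_def)

lemma incr_ray [simp]: "incr (translate (ray x) h) y = incr h y - (if y = x then 1 else 0)"
  by (auto simp: incr_translate ray_def desc_parent)

lemma translate_ray_M: "translate (ray x) h \<in> M \<longleftrightarrow> h \<in> M \<and> 1 \<le> incr h x"
proof
  assume *: "translate (ray x) h \<in> M"
  have "0 \<le> incr h y - (if y = x then 1 else 0)" for y
    using * by (auto simp: M_iff)
  then show "h \<in> M \<and> 1 \<le> incr h x"
    unfolding M_iff by (smt (verit, ccfv_threshold))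
qed (auto simp: M_iff)

text \<open>For a local event \<open>D\<close> a finite shift \<open>d\<close> that agrees with the
  ray on \<open>J\<close> moves the preimage of \<open>D \<inter> M\<close> into
  \<open>D \<inter> M\<close> without changing its measure. The moved set may be smaller than
  \<open>D \<inter> M\<close>, because \<open>d\<close> raises the increments just below its
  support; hence only an inequality, which then extends to all events.\<close>

lemma ray_domination:
  assumes "finite_measure \<mu>" and sets [simp]: "sets \<mu> = sets gradient_algebra"
    and inv: "\<And>d. finite {v. d v \<noteq> 0} \<Longrightarrow> invar \<mu> d"
    and C: "C \<in> sets gradient_algebra"
  shows "measure \<mu> (translate (ray x) -` (C \<inter> M)) \<le> measure \<mu> C"
proof -
  interpret finite_measure \<mu> by fact
  have [measurable_cong]: "sets \<mu> = sets gradient_algebra" by simp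
  have space [simp]: "space \<mu> = UNIV" using sets_eq_imp_space_eq[OF sets] by simp
  let ?t = "translate (ray x)"
  let ?N = "distr (density \<mu> (indicator (?t -` M))) gradient_algebra ?t"
  have N: "emeasure ?N D = emeasure \<mu> (?t -` (D \<inter> M))" if "D \<in> sets gradient_algebra" for D
    using that by (subst emeasure_distr) (auto simp: emeasure_restricted translate_vimage_sets Int_commute)
  then have N_measure: "measure ?N D = measure \<mu> (?t -` (D \<inter> M))" if "D \<in> sets gradient_algebra" for D
    using that by (simp add: measure_def)
  have "measure ?N C \<le> measure \<mu> C"
  proof (rule measure_le_from_algebra[OF algebra_local_sets \<open>finite_measure \<mu>\<close>])
    show "finite_measure ?N"
      by standard (use N[OF sets.top[of gradient_algebra, unfolded space_gradient]] in \<open>simp add: emeasure_eq_measure\<close>)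
    fix D :: "('v \<Rightarrow> int) set" assume "D \<in> local_sets"
    then obtain J where D: "D \<in> sets gradient_algebra" "finite J"
      "\<And>h h'. (\<forall>v\<in>J. h v = h' v) \<Longrightarrow> h \<in> D \<Longrightarrow> h' \<in> D"
      by (auto simp: local_sets_def)
    \<comment> \<open>\<open>U\<close> consists of the paths from the relevant vertices of
      \<open>J\<close> up to \<open>x\<close>. It is finite and closed under parents until
      \<open>x\<close>, so adding 1 on it lowers no increment other than the one at
      \<open>x\<close>.\<close>
    define U where "U = {w \<in> desc x. \<exists>v\<in>J \<inter> desc x. v \<in> desc w}"
    define d where "d = (\<lambda>v. if v \<in> U then 1 else 0 :: int)"
    have "\<forall>v. \<exists>n. v \<in> desc x \<longrightarrow> (p ^^ n) v = x" by (auto simp: desc_def)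
    then obtain depth where depth: "\<And>v. v \<in> desc x \<Longrightarrow> (p ^^ depth v) v = x"
      using choice[of "\<lambda>v n. v \<in> desc x \<longrightarrow> (p ^^ n) v = x"] by blast
    have "U \<subseteq> (\<Union>v\<in>J \<inter> desc x. (\<lambda>i. (p ^^ i) v) ` {..depth v})"
    proof
      fix w assume "w \<in> U"
      then obtain v i j where v: "v \<in> J \<inter> desc x" "(p ^^ i) v = w" "(p ^^ j) w = x"
        by (auto simp: U_def desc_def)
      then have "(p ^^ (j + i)) v = (p ^^ depth v) v" by (simp add: depth funpow_add)
      then have "i \<le> depth v" using funpow_inj[of "j + i" v "depth v"] by simp
      then show "w \<in> (\<Union>v\<in>J \<inter> desc x. (\<lambda>i. (p ^^ i) v) ` {..depth v})" using v by blast
    qed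
    then have "finite U" using D(2) finite_subset by blast
    then have inv': "invar \<mu> (\<lambda>v. - d v)"
      by (intro inv) (auto simp: d_def)
    have d_J: "d v = ray x v" if "v \<in> J" for v
    proof -
      have "v \<in> U \<longleftrightarrow> v \<in> desc x" using that desc_refl[of v] unfolding U_def by blast
      then show ?thesis by (simp add: d_def ray_def)
    qed
    have U_up: "p v \<in> U" if "v \<in> U" "v \<noteq> x" for v
    proof -
      have "u \<in> desc (p v)" if u: "u \<in> desc v" for u
      proof -
        obtain n where "(p ^^ n) u = v" using u by (auto simp: desc_def)
        then have "(p ^^ Suc n) u = p v" by simp
        then show ?thesis unfolding desc_def by blast
      qed
      then show ?thesis using that desc_parent[of v x] unfolding U_def by blast
    qed
    let ?X = "?t -` (D \<inter> M)"
    have X: "translate d h \<in> D" "h \<in> M" "1 \<le> incr h x" if "h \<in> ?X" for h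
    proof -
      have "\<forall>v\<in>J. ?t h v = translate d h v" by (simp add: translate_def d_J)
      then show "translate d h \<in> D" using D(3) that by blast
      show "h \<in> M" "1 \<le> incr h x" using that translate_ray_M by blast+
    qed
    \<comment> \<open>The image of \<open>?X\<close> under the finite shift, written as a preimage
      under its inverse. Positivity of the increment at \<open>x\<close> pays for the one increment
      that is lowered.\<close>
    have Y: "translate (\<lambda>v. - d v) -` ?X \<subseteq> D \<inter> M"
    proof
      fix g assume g: "g \<in> translate (\<lambda>v. - d v) -` ?X"
      define h where "h = translate (\<lambda>v. - d v) g"
      have gh: "g = translate d h" by (simp add: h_def)
      have h: "translate d h \<in> D" "h \<in> M" "1 \<le> incr h x"
        using X[of h] g by (auto simp: h_def)
      have "0 \<le> incr g y" for y
        using h(2,3) U_up[of y] unfolding M_iff gh incr_translate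
        by (cases "y = x") (auto simp: d_def dest: spec[of _ y])
      then show "g \<in> D \<inter> M" using h gh by (auto simp: M_iff)
    qed
    have "emeasure \<mu> (translate (\<lambda>v. - d v) -` ?X) = emeasure \<mu> ?X"
      using D X Y by (intro invarD[OF inv'] translate_vimage_sets sets.Int M_sets) blast+
    then have "measure \<mu> ?X = measure \<mu> (translate (\<lambda>v. - d v) -` ?X)"
      by (simp add: measure_def)
    also have "\<dots> \<le> measure \<mu> D"
      using Y D(1) by (intro finite_measure_mono) auto
    finally show "measure ?N D \<le> measure \<mu> D" using D by (simp add: N_measure)
  qed (use C in \<open>simp_all add: sets_gradient_local[symmetric]\<close>)
  then show ?thesis using C by (simp add: N_measure)
qed

text \<open>The set on the left is the event that the increment at \<open>x\<close> is positive and that \<open>C\<close> holds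
  after lowering it by one.\<close>

definition memoryless :: "('v \<Rightarrow> int) measure \<Rightarrow> 'v \<Rightarrow> real \<Rightarrow> bool" where
  "memoryless \<mu> x c \<longleftrightarrow> (\<forall>C\<in>sets gradient_algebra.
     measure \<mu> (translate (ray x) -` (C \<inter> M)) = c * measure \<mu> C)"

text \<open>Induction on the sum of the positive bounds: each step lowers one of them by one and
  yields a factor \<open>c x\<close>; without positive bounds the cylinder is almost surely
  everything. The total mass stays in the formula so that it also covers restrictions of a measure
  to an event.\<close>

lemma memoryless_cyl:
  assumes "finite_measure \<mu>" and sets [simp]: "sets \<mu> = sets gradient_algebra"
    and AE: "AE h in \<mu>. h \<in> M"
    and mem: "\<And>x. memoryless \<mu> x (c x)" and J: "finite J"
  shows "measure \<mu> (cyl J k) = measure \<mu> UNIV * (\<Prod>x\<in>J. c x ^ nat (k x))"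
proof -
  interpret finite_measure \<mu> by fact
  have space [simp]: "space \<mu> = UNIV" using sets_eq_imp_space_eq[OF sets] by simp
  show ?thesis
  proof (induction "\<Sum>x\<in>J. nat (k x)" arbitrary: k)
    case 0
    then have k: "k x \<le> 0" if "x \<in> J" for x using that J by auto
    have "measure \<mu> (cyl J k) = measure \<mu> UNIV"
    proof (rule measure_eq_AE, use AE in eventually_elim)
      fix h assume "h \<in> M"
      then have "k x \<le> incr h x" if "x \<in> J" for x
        using k[OF that] order_trans unfolding M_iff by blast
      then show "h \<in> cyl J k \<longleftrightarrow> h \<in> UNIV" by (auto simp: cyl_def)
    qed (use sets.top[of \<mu>] in \<open>auto simp: cyl_sets\<close>)
    moreover have "(\<Prod>x\<in>J. c x ^ nat (k x)) = 1"
      using k by (intro prod.neutral) auto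
    ultimately show ?case by simp
  next
    case (Suc n)
    then obtain x where x: "x \<in> J" "0 < k x"
      by (metis nat_0_iff not_le sum.neutral Zero_not_Suc)
    let ?k = "k(x := k x - 1)"
    have "(\<Sum>y\<in>J. nat (k y)) = nat (k x) + (\<Sum>y\<in>J - {x}. nat (k y))"
      using J x by (simp add: sum.remove)
    moreover have "(\<Sum>y\<in>J. nat (?k y)) = nat (k x - 1) + (\<Sum>y\<in>J - {x}. nat (k y))"
      using J x by (simp add: sum.remove)
    ultimately have n: "n = (\<Sum>y\<in>J. nat (?k y))"
      using Suc(2) x by linarith
    have "measure \<mu> (cyl J k) = measure \<mu> (translate (ray x) -` (cyl J ?k \<inter> M))"
    proof (rule measure_eq_AE, use AE in eventually_elim)
      fix h assume h: "h \<in> M"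
      have "?k y \<le> incr h y - (if y = x then 1 else 0) \<longleftrightarrow> k y \<le> incr h y" for y
        by auto
      moreover have "1 \<le> incr h x" if "k x \<le> incr h x" using that x by linarith
      ultimately show "h \<in> cyl J k \<longleftrightarrow> h \<in> translate (ray x) -` (cyl J ?k \<inter> M)"
        using x(1) h unfolding cyl_def by (simp only: translate_ray_M vimage_eq mem_Collect_eq Int_iff incr_ray) blast
    qed (use translate_vimage_sets[OF sets.Int[OF cyl_sets M_sets]] cyl_sets in simp_all)
    also have "\<dots> = c x * measure \<mu> (cyl J ?k)"
      using mem[of x] cyl_sets unfolding memoryless_def by blast
    also have "measure \<mu> (cyl J ?k) = measure \<mu> UNIV * (\<Prod>x\<in>J. c x ^ nat (?k x))"
      using n by (rule Suc(1))
    also have "(\<Prod>x\<in>J. c x ^ nat (?k x)) = c x ^ nat (k x - 1) * (\<Prod>y\<in>J - {x}. c y ^ nat (k y))"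
      using J x by (simp add: prod.remove)
    also have "c x * (measure \<mu> UNIV * (c x ^ nat (k x - 1) * (\<Prod>y\<in>J - {x}. c y ^ nat (k y))))
        = measure \<mu> UNIV * (c x ^ Suc (nat (k x - 1)) * (\<Prod>y\<in>J - {x}. c y ^ nat (k y)))"
      by simp
    also have "Suc (nat (k x - 1)) = nat (k x)" using x by simp
    also have "c x ^ nat (k x) * (\<Prod>y\<in>J - {x}. c y ^ nat (k y)) = (\<Prod>y\<in>J. c y ^ nat (k y))"
      using J x by (simp add: prod.remove)
    finally show ?case .
  qed
qed

lemma cyl_memoryless:
  assumes "prob_space \<mu>" and sets [simp]: "sets \<mu> = sets gradient_algebra"
    and AE: "AE h in \<mu>. h \<in> M"
    and cyl: "\<And>J k. finite J \<Longrightarrow> measure \<mu> (cyl J k) = (\<Prod>x\<in>J. c x ^ nat (k x))"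
  shows "memoryless \<mu> x (c x)"
proof -
  interpret prob_space \<mu> by fact
  have [measurable_cong]: "sets \<mu> = sets gradient_algebra" by simp
  have space [simp]: "space \<mu> = UNIV" using sets_eq_imp_space_eq[OF sets] by simp
  have "c x = measure \<mu> (cyl {x} (\<lambda>_. 1))" by (simp add: cyl)
  then have c: "0 \<le> c x" by simp
  let ?t = "translate (ray x)"
  let ?N = "distr (density \<mu> (indicator (?t -` M))) gradient_algebra ?t"
  have N: "emeasure ?N D = emeasure \<mu> (?t -` (D \<inter> M))" if "D \<in> sets gradient_algebra" for D
    using that by (subst emeasure_distr) (auto simp: emeasure_restricted translate_vimage_sets Int_commute)
  have "?N = scale_measure (ennreal (c x)) \<mu>"
  proof (rule measure_eqI_cyl)
    show "finite_measure ?N"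
      by standard (use N[OF sets.top[of gradient_algebra, unfolded space_gradient]] in \<open>simp add: emeasure_eq_measure\<close>)
    fix J :: "'v set" and k :: "'v \<Rightarrow> int" assume J: "finite J"
    \<comment> \<open>Positivity before lowering and the bound after lowering combine to one bound
      at \<open>x\<close>, where \<open>x\<close> may lie outside \<open>J\<close>.\<close>
    let ?k = "\<lambda>z. if z = x then (if x \<in> J then max 0 (k x) else 0) + 1 else k z"
    have "measure \<mu> (?t -` (cyl J k \<inter> M)) = measure \<mu> (cyl (insert x J) ?k)"
    proof (rule measure_eq_AE, use AE in eventually_elim)
      fix h assume "h \<in> M"
      then show "h \<in> ?t -` (cyl J k \<inter> M) \<longleftrightarrow> h \<in> cyl (insert x J) ?k"
        by (auto simp: cyl_def translate_ray_M split: if_splits)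
    qed (use translate_vimage_sets[OF sets.Int[OF cyl_sets M_sets]] cyl_sets in simp_all)
    also have "\<dots> = (\<Prod>z\<in>insert x J. c z ^ nat (?k z))"
      using J by (intro cyl) auto
    also have "\<dots> = c x ^ nat (?k x) * (\<Prod>z\<in>J - {x}. c z ^ nat (k z))"
      using J by (subst prod.insert_remove) (auto intro!: arg_cong2[of _ _ _ _ "(*)"] prod.cong)
    also have "\<dots> = c x * (\<Prod>z\<in>J. c z ^ nat (k z))"
    proof (cases "x \<in> J")
      case True
      have "nat (max 0 (k x) + 1) = Suc (nat (k x))" by auto
      then show ?thesis using True J by (simp add: prod.remove[of J x])
    next
      case False
      then show ?thesis by simp
    qed
    also have "\<dots> = c x * measure \<mu> (cyl J k)" using J by (simp add: cyl)
    finally show "emeasure ?N (cyl J k) = emeasure (scale_measure (ennreal (c x)) \<mu>) (cyl J k)"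
      using c by (simp add: N cyl_sets emeasure_eq_measure ennreal_mult)
  qed auto
  then have "emeasure \<mu> (?t -` (C \<inter> M)) = emeasure (scale_measure (ennreal (c x)) \<mu>) C"
    if "C \<in> sets gradient_algebra" for C
    using N[OF that] by simp
  then show ?thesis
    using c by (auto simp: memoryless_def emeasure_eq_measure simp flip: ennreal_mult)
qed

end

subsection \<open>Weights\<close>

text \<open>The ratio of the geometric law, equal to the probability of a value of at least 1. It
  turns sums of flows into products and sends \<infinity> to 0.\<close>

definition wt :: "ennreal \<Rightarrow> real" where
  "wt a = (if a = \<infinity> then 0 else exp (- enn2real a))"

lemma wt_nonneg [simp]: "0 \<le> wt a"
  by (simp add: wt_def)

lemma wt_zero [simp]: "wt 0 = 1"
  by (simp add: wt_def)

lemma wt_add: "wt (a + b) = wt a * wt b"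
  by (auto simp: wt_def enn2real_plus less_top exp_add[symmetric])

lemma wt_sum: "finite F \<Longrightarrow> wt (\<Sum>i\<in>F. f i) = (\<Prod>i\<in>F. wt (f i))"
  by (induction F rule: finite_induct) (auto simp: wt_add)

lemma wt_antimono: "a \<le> b \<Longrightarrow> wt b \<le> wt a"
  by (auto simp: wt_def enn2real_mono less_top top_unique)

lemma wt_inject: "wt a = wt b \<longleftrightarrow> a = b"
proof
  assume "wt a = wt b"
  then show "a = b"
    by (cases a; cases b) (auto simp: wt_def split: if_splits)
qed simp

lemma wt_surj:
  assumes "0 \<le> c" "c < 1"
  obtains a where "0 < a" "wt a = c"
proof (cases "c = 0")
  case True
  then show ?thesis using that[of \<infinity>] by (simp add: wt_def)
next
  case False
  then show ?thesis using assms that[of "ennreal (- ln c)"] by (simp add: wt_def)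
qed

text \<open>Continuity at \<infinity> is included because the flows through the children may add up
  to \<infinity>.\<close>

lemma wt_tendsto:
  assumes f: "(f \<longlongrightarrow> l) F"
  shows "((\<lambda>x. wt (f x)) \<longlongrightarrow> wt l) F"
proof (cases "l = \<infinity>")
  case False
  then have l: "l < \<infinity>" by (simp add: less_top)
  have "eventually (\<lambda>x. f x < \<infinity>) F"
    using order_tendstoD(2)[OF f l] .
  then have "eventually (\<lambda>x. exp (- enn2real (f x)) = wt (f x)) F"
    by eventually_elim (auto simp: wt_def)
  moreover have "((\<lambda>x. exp (- enn2real (f x))) \<longlongrightarrow> exp (- enn2real l)) F"
    using l f by (intro tendsto_intros tendsto_enn2real) auto
  ultimately show ?thesis
    using False by (simp add: wt_def[of l] tendsto_cong)
next
  case True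
  have "((\<lambda>x. wt (f x)) \<longlongrightarrow> 0) F"
  proof (rule order_tendstoI)
    fix e :: real assume "0 < e"
    \<comment> \<open>The term 1 - ln e makes exp(-K) smaller than e; the maximum with 0 keeps
      \<open>ennreal K\<close> from being truncated.\<close>
    define K where "K = max 0 (1 - ln e)"
    have "wt (ennreal K) = exp (- K)"
      unfolding wt_def by (subst enn2real_ennreal) (auto simp: K_def)
    have "eventually (\<lambda>x. ennreal K < f x) F"
      using True by (intro order_tendstoD(1)[OF f]) simp
    then show "eventually (\<lambda>x. wt (f x) < e) F"
    proof eventually_elim
      case (elim x)
      have "wt (f x) \<le> exp (- K)"
        using wt_antimono[OF less_imp_le[OF elim]] \<open>wt (ennreal K) = exp (- K)\<close> by simp
      also have "\<dots> < exp (ln e)" by (simp add: K_def)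
      finally show ?case using \<open>0 < e\<close> by simp
    qed
  next
    fix e :: real assume "e < 0"
    then show "eventually (\<lambda>x. e < wt (f x)) F"
      by (intro always_eventually allI) (rule less_le_trans[OF _ wt_nonneg])
  qed
  then show ?thesis using True by (simp add: wt_def)
qed

lemma measure_Geom:
  assumes "0 < a"
  shows "measure (measure_pmf (Geom a)) {n..} = wt a ^ n"
proof -
  have "(\<Sum>k<n. pmf (Geom a) k) = 1 - wt a ^ n"
  proof (cases "a = \<infinity>")
    case True
    then show ?thesis by (cases n) (auto simp: Geom_def wt_def sum.lessThan_Suc_shift simp del: sum.lessThan_Suc)
  next
    case False
    then have "a < \<infinity>" by (simp add: less_top)
    then have "pmf (Geom a) k = (1 - wt a) * wt a ^ k" for k
      using assms pmf_Geom[of a k] False by (simp add: wt_def exp_of_nat_mult[symmetric])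
    then show ?thesis
      by (simp add: sum_distrib_left[symmetric] one_diff_power_eq)
  qed
  moreover have "measure (measure_pmf (Geom a)) {n..} = 1 - measure (measure_pmf (Geom a)) {..<n}"
    using measure_pmf.prob_compl[of "{..<n}" "Geom a"] by (simp add: Compl_eq_Diff_UNIV[symmetric])
  ultimately show ?thesis
    by (simp add: measure_measure_pmf_finite)
qed

lemma measure_int_Geom:
  assumes "0 < a"
  shows "measure (measure_pmf (map_pmf int (Geom a))) {k..} = wt a ^ nat k"
proof -
  have "int -` {k..} = {nat k..}" by auto
  then show ?thesis using assms by (simp add: measure_Geom)
qed

lemma measure_eqI_atLeast_int:
  fixes M N :: "int measure"
  assumes "finite_measure M"
    and sets: "sets M = UNIV" "sets N = UNIV"
    and eq: "\<And>k. emeasure M {k..} = emeasure N {k..}"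
  shows "M = N"
proof (rule measure_eqI_generator_eq[where \<Omega> = UNIV and E = "range atLeast" and A = "\<lambda>i. {- int i..}"])
  show "Int_stable (range (atLeast :: int \<Rightarrow> int set))"
  proof (rule Int_stableI)
    fix a b :: "int set" assume "a \<in> range atLeast" "b \<in> range atLeast"
    then obtain k l where "a = {k..}" "b = {l..}" by blast
    then have "a \<inter> b = {max k l..}" by auto
    then show "a \<inter> b \<in> range atLeast" by blast
  qed
  have "A \<in> sigma_sets UNIV (range atLeast)" for A :: "int set"
  proof -
    have "{k} \<in> sigma_sets UNIV (range atLeast)" for k :: int
    proof -
      interpret sigma_algebra UNIV "sigma_sets UNIV (range (atLeast :: int \<Rightarrow> int set))"
        by (rule sigma_algebra_sigma_sets) simp
      have "{k} = {k..} - {k+1..}" by auto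
      then show ?thesis by (metis Diff rangeI sigma_sets.Basic)
    qed
    then have "(\<Union>k\<in>A. {k}) \<in> sigma_sets UNIV (range atLeast)"
      by (intro sigma_algebra.countable_UN'[OF sigma_algebra_sigma_sets]) auto
    then show ?thesis by simp
  qed
  then have all: "sigma_sets UNIV (range atLeast) = (UNIV :: int set set)" by auto
  show "sets M = sigma_sets UNIV (range atLeast)" "sets N = sigma_sets UNIV (range atLeast)"
    using sets all by auto
  show "emeasure M {- int i..} \<noteq> \<infinity>" for i
    using finite_measure.emeasure_finite[OF assms(1)] by simp
  show "(\<Union>i. {- int i..}) = UNIV"
  proof (intro equalityI subsetI UNIV_I)
    fix k :: int
    have "k \<in> {- int (nat (- k))..}" by auto
    then show "k \<in> (\<Union>i. {- int i..})" by blast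
  qed
qed (use eq in auto)

context parent_map
begin

subsection \<open>Flow measures\<close>

lemma flow_measure_cyl:
  assumes flow: "is_flow_measure edges \<phi> \<mu>" and pos: "\<And>x. 0 < \<phi> (x, p x)" and J: "finite J"
  shows "measure \<mu> (cyl J k) = (\<Prod>x\<in>J. wt (\<phi> (x, p x)) ^ nat (k x))"
proof (cases "J = {}")
  case True
  interpret prob_space \<mu> using flow by (simp add: is_flow_measure_def)
  have "space \<mu> = UNIV" using flow by (simp add: is_flow_measure_def)
  then show ?thesis using True prob_space by (simp add: cyl_def)
next
  case False
  interpret prob_space \<mu> using flow by (simp add: is_flow_measure_def)
  have space [simp]: "space \<mu> = UNIV" and sets: "sets \<mu> = sets gradient_algebra"
    using flow by (simp_all add: is_flow_measure_def)
  have [measurable_cong]: "sets \<mu> = sets gradient_algebra" by (rule sets)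
  let ?X = "\<lambda>(x, y) h. h y - h x :: int"
  let ?J = "(\<lambda>x. (x, p x)) ` J"
  let ?A = "\<lambda>e. {k (fst e)..}"
  have "prob (\<Inter>e\<in>?J. ?X e -` ?A e \<inter> space \<mu>) = (\<Prod>e\<in>?J. prob (?X e -` ?A e \<inter> space \<mu>))"
    using flow False J by (intro indep_varsD[of "\<lambda>_. count_space UNIV" ?X edges]) (auto simp: is_flow_measure_def)
  also have "(\<Inter>e\<in>?J. ?X e -` ?A e \<inter> space \<mu>) = cyl J k"
    using False by (auto simp: cyl_def incr_def)
  also have "(\<Prod>e\<in>?J. prob (?X e -` ?A e \<inter> space \<mu>)) = (\<Prod>x\<in>J. prob (?X (x, p x) -` ?A (x, p x) \<inter> space \<mu>))"
    by (subst prod.reindex) (auto simp: inj_on_def)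
  also have "\<dots> = (\<Prod>x\<in>J. wt (\<phi> (x, p x)) ^ nat (k x))"
  proof (rule prod.cong[OF refl])
    fix x assume "x \<in> J"
    have "prob (?X (x, p x) -` ?A (x, p x) \<inter> space \<mu>)
        = measure (distr \<mu> (count_space UNIV) (\<lambda>h. h (p x) - h x)) {k x..}"
      by (subst measure_distr) auto
    also have "distr \<mu> (count_space UNIV) (\<lambda>h. h (p x) - h x) = measure_pmf (map_pmf int (Geom (\<phi> (x, p x))))"
      using flow by (auto simp: is_flow_measure_def)
    finally show "prob (?X (x, p x) -` ?A (x, p x) \<inter> space \<mu>) = wt (\<phi> (x, p x)) ^ nat (k x)"
      by (simp add: measure_int_Geom pos del: measure_map_pmf)
  qed
  finally show ?thesis .
qed

text \<open>Cylinders over one vertex are an intersection-stable generator of the events of its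
  increment, so the product formula yields both the marginals and independence.\<close>

lemma cyl_flow_measure:
  assumes "prob_space \<mu>" and sets [simp]: "sets \<mu> = sets gradient_algebra"
    and pos: "\<And>x. 0 < \<phi> (x, p x)"
    and cyl: "\<And>J k. finite J \<Longrightarrow> measure \<mu> (cyl J k) = (\<Prod>x\<in>J. wt (\<phi> (x, p x)) ^ nat (k x))"
  shows "is_flow_measure edges \<phi> \<mu>"
proof -
  interpret prob_space \<mu> by fact
  have space [simp]: "space \<mu> = UNIV" using sets_eq_imp_space_eq[OF sets] by simp
  have [measurable_cong]: "sets \<mu> = sets gradient_algebra" by (rule sets)
  let ?X = "\<lambda>(x, y) h. h y - h x :: int"
  have dist: "distr \<mu> (count_space UNIV) (\<lambda>h. h (p x) - h x) = measure_pmf (map_pmf int (Geom (\<phi> (x, p x))))" for x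
  proof (rule measure_eqI_atLeast_int)
    have [measurable]: "(\<lambda>h. h (p x) - h x) \<in> measurable \<mu> (count_space UNIV)" by measurable
    interpret D: prob_space "distr \<mu> (count_space UNIV) (\<lambda>h. h (p x) - h x)"
      by (rule prob_space_distr) measurable
    show "finite_measure (distr \<mu> (count_space UNIV) (\<lambda>h. h (p x) - h x))"
      by (rule D.finite_measure_axioms)
    fix k :: int
    have "measure (distr \<mu> (count_space UNIV) (\<lambda>h. h (p x) - h x)) {k..} = measure \<mu> (cyl {x} (\<lambda>_. k))"
      by (subst measure_distr) (auto simp: cyl_def incr_def vimage_def)
    then show "emeasure (distr \<mu> (count_space UNIV) (\<lambda>h. h (p x) - h x)) {k..}
        = emeasure (measure_pmf (map_pmf int (Geom (\<phi> (x, p x))))) {k..}"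
      by (simp add: D.emeasure_eq_measure measure_pmf.emeasure_eq_measure cyl measure_int_Geom pos
               del: measure_map_pmf emeasure_map_pmf)
  qed auto
  have "indep_vars (\<lambda>_. count_space UNIV) ?X edges"
    unfolding indep_vars_def2
  proof (intro conjI ballI)
    fix e :: "'v \<times> 'v" assume "e \<in> edges"
    then show "?X e \<in> measurable \<mu> (count_space UNIV)" by auto
  next
    let ?F = "\<lambda>e. range (\<lambda>k. cyl {fst e} (\<lambda>_. k))"
    have "indep_sets ?F edges"
    proof (rule indep_setsI)
      fix e show "?F e \<subseteq> events" by (auto intro: cyl_sets)
    next
      fix A J assume J: "J \<noteq> {}" "J \<subseteq> edges" "finite J" and A: "\<forall>j\<in>J. A j \<in> ?F j"
      from A obtain k where k: "\<And>e. e \<in> J \<Longrightarrow> A e = cyl {fst e} (\<lambda>_. k e)"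
        using bchoice[of J "\<lambda>e k. A e = cyl {fst e} (\<lambda>_. k)"] by blast
      have "e = (fst e, p (fst e))" if "e \<in> J" for e using that J(2) by auto
      then have inj: "inj_on fst J" by (intro inj_onI) metis
      have "(\<Inter>e\<in>J. A e) = cyl (fst ` J) (\<lambda>x. k (x, p x))"
        using k J(1,2) by (force simp: cyl_def)
      then have "prob (\<Inter>e\<in>J. A e) = (\<Prod>e\<in>J. wt (\<phi> (fst e, p (fst e))) ^ nat (k (fst e, p (fst e))))"
        using J inj by (simp add: cyl prod.reindex)
      also have "\<dots> = (\<Prod>e\<in>J. prob (A e))"
      proof (rule prod.cong[OF refl])
        fix e assume "e \<in> J"
        then have "(fst e, p (fst e)) = e" using J(2) by auto
        then show "wt (\<phi> (fst e, p (fst e))) ^ nat (k (fst e, p (fst e))) = prob (A e)"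
          using k[OF \<open>e \<in> J\<close>] by (simp add: cyl)
      qed
      finally show "prob (\<Inter>e\<in>J. A e) = (\<Prod>e\<in>J. prob (A e))" .
    qed
    then have "indep_sets (\<lambda>e. sigma_sets (space \<mu>) (?F e)) edges"
    proof (rule indep_sets_sigma)
      fix e
      show "Int_stable (?F e)"
      proof (rule Int_stableI)
        fix a b assume "a \<in> ?F e" "b \<in> ?F e"
        then obtain k l where "a = cyl {fst e} (\<lambda>_. k)" "b = cyl {fst e} (\<lambda>_. l)" by blast
        then have "a \<inter> b = cyl {fst e} (\<lambda>_. max k l)" by (auto simp: cyl_def)
        then show "a \<inter> b \<in> ?F e" by blast
      qed
    qed
    then show "indep_sets (\<lambda>e. {?X e -` A \<inter> space \<mu> | A. A \<in> sets (count_space UNIV)}) edges"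
    proof (rule indep_sets_mono_sets)
      fix e :: "'v \<times> 'v" assume "e \<in> edges"
      then obtain x where e: "e = (x, p x)" by blast
      let ?N = "sigma UNIV (?F e)"
      have [simp]: "space ?N = UNIV" "sets ?N = sigma_sets UNIV (?F e)"
        by (simp_all add: space_measure_of_conv)
      have cN: "cyl {x} (\<lambda>_. k) \<in> sets ?N" for k
        by (auto intro!: sigma_sets.Basic simp: e)
      have "(\<lambda>h. incr h x) \<in> measurable ?N (count_space UNIV)"
      proof (subst measurable_count_space_eq2_countable, safe)
        fix k :: int
        have "(\<lambda>h. incr h x) -` {k} \<inter> space ?N = cyl {x} (\<lambda>_. k) - cyl {x} (\<lambda>_. k + 1)"
          by (auto simp: cyl_def)
        then show "(\<lambda>h. incr h x) -` {k} \<inter> space ?N \<in> sets ?N"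
          by (simp only:) (intro sets.Diff cN)
      qed auto
      from measurable_sets[OF this]
      show "{?X e -` A \<inter> space \<mu> | A. A \<in> sets (count_space UNIV)} \<subseteq> sigma_sets (space \<mu>) (?F e)"
        by (auto simp: e incr_def)
    qed
  qed
  then show ?thesis
    using dist \<open>prob_space \<mu>\<close> by (auto simp: is_flow_measure_def)
qed

lemma flow_measure_unique:
  assumes "is_flow_measure edges \<phi> \<mu>" "is_flow_measure edges \<phi> \<nu>" "\<And>x. 0 < \<phi> (x, p x)"
  shows "\<mu> = \<nu>"
proof (rule measure_eqI_cyl)
  interpret M: prob_space \<mu> using assms by (simp add: is_flow_measure_def)
  interpret N: prob_space \<nu> using assms by (simp add: is_flow_measure_def)
  show "sets \<mu> = sets gradient_algebra" "sets \<nu> = sets gradient_algebra"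
    using assms by (simp_all add: is_flow_measure_def)
  show "finite_measure \<mu>" by (rule M.finite_measure_axioms)
  fix J :: "'v set" and k :: "'v \<Rightarrow> int" assume "finite J"
  then show "emeasure \<mu> (cyl J k) = emeasure \<nu> (cyl J k)"
    using assms by (simp add: M.emeasure_eq_measure N.emeasure_eq_measure flow_measure_cyl)
qed

text \<open>Heights are found by putting height 0 at a reference vertex \<open>r\<close> and summing
  prescribed increments along the ascents of \<open>r\<close> and \<open>v\<close> to a common
  ancestor.\<close>

lemma exists_heights:
  obtains H :: "('v \<Rightarrow> int) \<Rightarrow> 'v \<Rightarrow> int" where "\<And>w x. incr (H w) x = w x"
proof -
  fix r :: 'v
  have "\<forall>v. \<exists>m n. (p ^^ m) v = (p ^^ n) r" using common_ancestor by blast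
  then obtain m n where mn: "\<And>v. (p ^^ m v) v = (p ^^ n v) r" by metis
  define s where "s = (\<lambda>w v k. \<Sum>i<k. w ((p ^^ i) v) :: int)"
  define H where "H = (\<lambda>w v. s w r (n v) - s w v (m v))"
  \<comment> \<open>The value does not depend on the meeting point: two meeting points differ by a
    common further ascent, whose contributions cancel.\<close>
  have H: "H w v = s w r j - s w v i" if "(p ^^ i) v = (p ^^ j) r" for w v i j
  proof -
    have extend: "s w r (j + l) - s w v (i + l) = s w r j - s w v i" if "(p ^^ i) v = (p ^^ j) r" for i j l
    proof (induction l)
      case (Suc l)
      have "(p ^^ (l + i)) v = (p ^^ (l + j)) r"
        using that by (simp add: funpow_add)
      then have "(p ^^ (i + l)) v = (p ^^ (j + l)) r" by (simp only: add.commute)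
      then show ?case using Suc by (simp add: s_def)
    qed simp
    show ?thesis
    proof (cases "m v \<le> i")
      case True
      then obtain l where l: "i = m v + l" by (metis le_Suc_ex)
      then have "(p ^^ (l + n v)) r = (p ^^ j) r"
        using that mn[of v] by (simp add: add.commute[of _ l] funpow_add)
      then have "j = n v + l" using funpow_inj[of "l + n v" r j] by simp
      then show ?thesis using extend[OF mn[of v], of l] l by (simp add: H_def)
    next
      case False
      then obtain l where l: "m v = i + l" by (metis le_Suc_ex nat_le_linear)
      then have "(p ^^ (l + j)) r = (p ^^ n v) r"
        using that mn[of v] by (simp add: add.commute[of _ l] funpow_add)
      then have "n v = j + l" using funpow_inj[of "l + j" r "n v"] by simp
      then show ?thesis using extend[OF that, of l] l by (simp add: H_def)
    qed
  qed
  have "incr (H w) x = w x" for w x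
  proof -
    have "(p ^^ Suc (m (p x))) x = (p ^^ n (p x)) r"
      using mn[of "p x"] by (simp add: funpow_swap1)
    then have "H w x = s w r (n (p x)) - s w x (Suc (m (p x)))" by (rule H)
    moreover have "s w x (Suc k) = w x + s w (p x) k" for k
      unfolding s_def sum.lessThan_Suc_shift by (simp add: funpow_swap1)
    ultimately show ?thesis using mn[of "p x"] by (simp add: incr_def H)
  qed
  then show thesis by (rule that)
qed

text \<open>The measure is the law of \<open>H\<close> applied to independent geometric coordinates.
  The increments of \<open>H w\<close> are the coordinates of \<open>w\<close>, which gives
  measurability as well as the cylinder probabilities.\<close>

lemma flow_measure_exists:
  assumes pos: "\<And>x. 0 < \<phi> (x, p x)"
  shows "\<exists>\<mu>. is_flow_measure edges \<phi> \<mu>"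
proof -
  obtain H :: "('v \<Rightarrow> int) \<Rightarrow> 'v \<Rightarrow> int" where H: "\<And>w x. incr (H w) x = w x"
    using exists_heights by blast
  define G where "G = (\<lambda>x. measure_pmf (map_pmf int (Geom (\<phi> (x, p x)))))"
  interpret product_prob_space G UNIV
    unfolding G_def by standard
  define P where "P = PiM UNIV G"
  have H_meas [measurable]: "H \<in> measurable P gradient_algebra"
  proof (rule measurable_differences_from_incr)
    fix x
    have "(\<lambda>w. w x) \<in> measurable P (G x)" unfolding P_def by measurable
    moreover have "measurable P (G x) = measurable P (count_space UNIV)"
      by (rule measurable_cong_sets) (simp_all add: G_def)
    ultimately show "(\<lambda>w. incr (H w) x) \<in> measurable P (count_space UNIV)"
      by (simp add: H)
  qed
  have "prob_space P" unfolding P_def by (rule P.prob_space_axioms)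
  then have "prob_space (distr P gradient_algebra H)"
    by (rule prob_space.prob_space_distr) measurable
  moreover have "measure (distr P gradient_algebra H) (cyl J k) = (\<Prod>x\<in>J. wt (\<phi> (x, p x)) ^ nat (k x))"
    if "finite J" for J k
  proof -
    have "measure (distr P gradient_algebra H) (cyl J k) = measure P (H -` cyl J k \<inter> space P)"
      by (subst measure_distr) (auto intro: cyl_sets)
    also have "H -` cyl J k \<inter> space P = prod_emb UNIV G J (Pi\<^sub>E J (\<lambda>x. {k x..}))"
      by (auto simp: cyl_def H P_def prod_emb_def space_PiM)
    also have "measure P \<dots> = (\<Prod>x\<in>J. measure (G x) {k x..})"
      unfolding P_def using that by (intro measure_PiM_emb) (auto simp: G_def)
    also have "\<dots> = (\<Prod>x\<in>J. wt (\<phi> (x, p x)) ^ nat (k x))"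
      by (simp add: G_def measure_int_Geom pos del: measure_map_pmf)
    finally show ?thesis .
  qed
  ultimately show ?thesis
    using cyl_flow_measure[of "distr P gradient_algebra H" \<phi>] pos by auto
qed

lemma flow_measure_is_flow:
  assumes "\<And>x. 0 < \<phi> (x, p x)"
  shows "is_flow_measure edges \<phi> (flow_measure edges \<phi>)"
  unfolding flow_measure_def
  by (rule theI', rule ex_ex1I, rule flow_measure_exists, rule assms,
      rule flow_measure_unique, assumption+, rule assms)

lemma cyl_AE_M:
  assumes "prob_space \<mu>" and sets: "sets \<mu> = sets gradient_algebra"
    and cyl: "\<And>J k. finite J \<Longrightarrow> measure \<mu> (cyl J k) = (\<Prod>x\<in>J. c x ^ nat (k x))"
  shows "AE h in \<mu>. h \<in> M"
proof -
  interpret prob_space \<mu> by fact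
  have "AE h in \<mu>. 0 \<le> incr h x" for x
  proof -
    have "prob (cyl {x} (\<lambda>_. 0)) = 1" by (simp add: cyl)
    then have "AE h in \<mu>. h \<in> cyl {x} (\<lambda>_. 0)" by (rule AE_prob_1)
    then show ?thesis by (simp add: cyl_def)
  qed
  then show ?thesis by (simp add: M_iff AE_all_countable)
qed

subsection \<open>The flow equation\<close>

lemma flow_edge_sum:
  "(\<Sum>\<^sub>\<infinity>z\<in>{z. (z, x) \<in> edges}. \<phi> (z, x)) = (\<Sum>\<^sub>\<infinity>z\<in>{z. p z = x}. \<phi> (z, p z))"
  by (rule infsum_cong_neutral) auto

text \<open>The children numbered below \<open>n\<close> form finite sets that eventually contain
  any given finite set of children, so their partial sums reach the unordered sum; \<open>wt\<close>
  makes products of them.\<close>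

lemma children_product_tendsto:
  "(\<lambda>n. \<Prod>z | p z = x \<and> to_nat z < n. wt (f z)) \<longlonglongrightarrow> wt (\<Sum>\<^sub>\<infinity>z\<in>{z. p z = x}. f z)"
proof -
  let ?K = "{z. p z = x}" and ?F = "\<lambda>n. {z. p z = x \<and> to_nat z < n}"
  have fin: "finite (?F n)" for n
    by (rule finite_imageD[of to_nat]) (auto intro: finite_subset[of _ "{..<n}"] inj_onI)
  have "filterlim ?F (finite_subsets_at_top ?K) sequentially"
    unfolding filterlim_finite_subsets_at_top
  proof (intro allI impI)
    fix X :: "'v set" assume X: "finite X \<and> X \<subseteq> ?K"
    then obtain N where N: "\<forall>z\<in>X. to_nat z < N"
      using finite_nat_set_iff_bounded[of "to_nat ` X"] by auto
    show "eventually (\<lambda>n. finite (?F n) \<and> X \<subseteq> ?F n \<and> ?F n \<subseteq> ?K) sequentially"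
    proof (rule eventually_sequentiallyI[of N])
      fix n assume "N \<le> n"
      then have "X \<subseteq> ?F n" using N X by (auto intro: less_le_trans)
      then show "finite (?F n) \<and> X \<subseteq> ?F n \<and> ?F n \<subseteq> ?K" using fin by blast
    qed
  qed
  moreover have "(sum f \<longlongrightarrow> (\<Sum>\<^sub>\<infinity>z\<in>?K. f z)) (finite_subsets_at_top ?K)"
    using has_sum_infsum[OF nonneg_summable_on_complete[of ?K f]] by (simp add: has_sum_def)
  ultimately have "(\<lambda>n. \<Sum>z\<in>?F n. f z) \<longlonglongrightarrow> (\<Sum>\<^sub>\<infinity>z\<in>?K. f z)"
    by (rule filterlim_compose[rotated])
  from wt_tendsto[OF this] show ?thesis by (simp add: wt_sum fin)
qed

lemma children_measure_tendsto:
  assumes "finite_measure \<mu>" "sets \<mu> = sets gradient_algebra" "C \<in> sets gradient_algebra"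
  shows "(\<lambda>n. measure \<mu> (cyl {z. p z = x \<and> to_nat z < n} (\<lambda>_. 1) \<inter> C)) \<longlonglongrightarrow>
    measure \<mu> (cyl {z. p z = x} (\<lambda>_. 1) \<inter> C)"
proof -
  interpret finite_measure \<mu> by fact
  let ?C = "\<lambda>n. cyl {z. p z = x \<and> to_nat z < n} (\<lambda>_. 1) \<inter> C"
  have "range ?C \<subseteq> sets \<mu>"
    unfolding assms(2) using assms(3) cyl_sets by blast
  moreover have "decseq ?C"
  proof (rule decseq_SucI)
    show "?C (Suc n) \<subseteq> ?C n" for n unfolding cyl_def by fastforce
  qed
  ultimately have "(\<lambda>n. measure \<mu> (?C n)) \<longlonglongrightarrow> measure \<mu> (\<Inter>n. ?C n)"
    by (rule finite_Lim_measure_decseq)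
  also have "(\<Inter>n. cyl {z. p z = x \<and> to_nat z < n} (\<lambda>_. 1) \<inter> C) = cyl {z. p z = x} (\<lambda>_. 1) \<inter> C"
    by (auto simp: cyl_def)
  finally show ?thesis .
qed


subsection \<open>Flow measures are Gibbs\<close>

definition site :: "'v \<Rightarrow> 'v \<Rightarrow> int" where
  "site x v = (if v = x then 1 else 0)"

lemma parent_neq: "p x \<noteq> x"
  using acyclic[of 1 x] by auto

lemma incr_site: "incr (translate (site x) h) y = incr h y + (if p y = x then 1 else 0) - (if y = x then 1 else 0)"
  by (auto simp: incr_translate site_def)

lemma translate_site_M:
  "h \<in> M \<Longrightarrow> translate (site x) h \<in> M \<longleftrightarrow> h \<in> cyl {x} (\<lambda>_. 1)"
proof
  assume "translate (site x) h \<in> M"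
  then have "0 \<le> incr (translate (site x) h) x" by (simp add: M_iff)
  then show "h \<in> cyl {x} (\<lambda>_. 1)" using parent_neq[of x] by (simp add: cyl_def incr_site)
next
  assume "h \<in> M" "h \<in> cyl {x} (\<lambda>_. 1)"
  then have "0 \<le> incr (translate (site x) h) y" for y
    using parent_neq[of x] by (cases "y = x") (auto simp: M_iff cyl_def incr_site)
  then show "translate (site x) h \<in> M" by (simp add: M_iff)
qed

lemma translate_site_children:
  assumes "h \<in> M"
  shows "translate (site x) h \<in> cyl {z. p z = x} (\<lambda>_. 1)"
proof -
  have "1 \<le> incr (translate (site x) h) z" if "p z = x" for z
  proof -
    have "z \<noteq> x" using that parent_neq[of x] by auto
    then show ?thesis using assms that by (simp add: incr_site M_iff)
  qed
  then show ?thesis by (simp add: cyl_def)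
qed

text \<open>A finite version of the balance under adding 1 at \<open>x\<close>, with
  \<open>F\<close> in place of all children. It is cross-multiplied because the ratios may
  vanish.\<close>

lemma site_cylinder_balance:
  assumes J: "finite J" and F: "finite F" "J \<inter> {z. p z = x} \<subseteq> F" "F \<subseteq> {z. p z = x}"
    and "prob_space \<mu>" and sets [simp]: "sets \<mu> = sets gradient_algebra"
    and AE: "AE h in \<mu>. h \<in> M"
    and cyl: "\<And>J k. finite J \<Longrightarrow> measure \<mu> (cyl J k) = (\<Prod>x\<in>J. c x ^ nat (k x))"
  shows "measure \<mu> (cyl F (\<lambda>_. 1) \<inter> cyl J k) * c x =
    measure \<mu> (cyl {x} (\<lambda>_. 1) \<inter> translate (site x) -` cyl J k) * (\<Prod>z\<in>F. c z)"
proof -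
  let ?J = "insert x (J \<union> F)"
  \<comment> \<open>Both events become cylinders over the base \<open>?J\<close>, since a bound of
    at most 0 costs nothing on \<open>M\<close>. Passing from \<open>b\<close> to \<open>a\<close>
    adds one power of \<open>c x\<close> at \<open>x\<close> and removes one power of
    \<open>c z\<close> at each \<open>z\<close> in \<open>F\<close>; elsewhere the exponents
    agree.\<close>
  define \<kappa> where "\<kappa> = (\<lambda>z. if z \<in> J then k z else 0)"
  define a where "a = (\<lambda>z. if z = x then max 0 (\<kappa> x) + 1 else if p z = x then \<kappa> z - 1 else \<kappa> z)"
  define b where "b = (\<lambda>z. if z \<in> F then max 1 (\<kappa> z) else \<kappa> z)"
  have xF: "x \<notin> F" using F parent_neq[of x] by auto
  have "measure \<mu> (cyl F (\<lambda>_. 1) \<inter> cyl J k) = measure \<mu> (cyl ?J b)"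
  proof (rule measure_eq_AE, use AE in eventually_elim)
    fix h assume "h \<in> M"
    then have pos: "0 \<le> incr h y" for y by (simp add: M_iff)
    show "h \<in> cyl F (\<lambda>_. 1) \<inter> cyl J k \<longleftrightarrow> h \<in> cyl ?J b"
    proof
      assume *: "h \<in> cyl F (\<lambda>_. 1) \<inter> cyl J k"
      have "b y \<le> incr h y" for y
        using * pos[of y] by (auto simp: b_def \<kappa>_def cyl_def)
      then show "h \<in> cyl ?J b" by (simp add: cyl_def)
    next
      assume *: "h \<in> cyl ?J b"
      have "1 \<le> incr h y" if "y \<in> F" for y
      proof -
        have "b y \<le> incr h y" using * that by (simp add: cyl_def)
        then show ?thesis using that by (simp add: b_def)
      qed
      moreover have "k y \<le> incr h y" if "y \<in> J" for y
      proof -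
        have "b y \<le> incr h y" using * that by (simp add: cyl_def)
        then show ?thesis using that by (simp add: b_def \<kappa>_def split: if_splits)
      qed
      ultimately show "h \<in> cyl F (\<lambda>_. 1) \<inter> cyl J k" by (simp add: cyl_def)
    qed
  qed (simp_all add: sets.Int cyl_sets)
  moreover have "measure \<mu> (cyl {x} (\<lambda>_. 1) \<inter> translate (site x) -` cyl J k) = measure \<mu> (cyl ?J a)"
  proof (rule measure_eq_AE, use AE in eventually_elim)
    fix h assume "h \<in> M"
    then have pos: "0 \<le> incr h y" for y by (simp add: M_iff)
    show "h \<in> cyl {x} (\<lambda>_. 1) \<inter> translate (site x) -` cyl J k \<longleftrightarrow> h \<in> cyl ?J a"
    proof
      assume *: "h \<in> cyl {x} (\<lambda>_. 1) \<inter> translate (site x) -` cyl J k"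
      then have 1: "1 \<le> incr h x" by (simp add: cyl_def)
      have 2: "k y \<le> incr h y + (if p y = x then 1 else 0) - (if y = x then 1 else 0)" if "y \<in> J" for y
        using * that by (simp add: cyl_def incr_site)
      have "a y \<le> incr h y" for y
        using 1 2[of y] pos[of y] parent_neq[of y] by (auto simp: a_def \<kappa>_def)
      then show "h \<in> cyl ?J a" by (simp add: cyl_def)
    next
      assume *: "h \<in> cyl ?J a"
      then have "a x \<le> incr h x" by (simp add: cyl_def)
      moreover have "1 \<le> a x" by (simp add: a_def)
      moreover have "k y \<le> incr h y + (if p y = x then 1 else 0) - (if y = x then 1 else 0)" if "y \<in> J" for y
      proof -
        have "a y \<le> incr h y" using * that by (simp add: cyl_def)
        then show ?thesis using that parent_neq[of y] by (auto simp: a_def \<kappa>_def split: if_splits)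
      qed
      ultimately show "h \<in> cyl {x} (\<lambda>_. 1) \<inter> translate (site x) -` cyl J k"
        by (simp add: cyl_def incr_site)
    qed
  qed (simp_all add: sets.Int cyl_sets translate_vimage_sets)
  moreover have "(\<Prod>z\<in>?J. c z ^ nat (b z)) * c x = (\<Prod>z\<in>?J. c z ^ nat (a z)) * (\<Prod>z\<in>F. c z)"
  proof -
    have "(\<Prod>z\<in>?J. if z = x then c z else 1) = c x"
      using J F by (subst prod.delta) auto
    moreover have "(\<Prod>z\<in>?J. if z \<in> F then c z else 1) = (\<Prod>z\<in>F. c z)"
      using J F by (subst prod.inter_restrict[symmetric]) (auto intro!: prod.cong)
    moreover have "c z ^ nat (b z) * (if z = x then c z else 1) = c z ^ nat (a z) * (if z \<in> F then c z else 1)"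
      if "z \<in> ?J" for z
    proof -
      consider "z = x" | "z \<noteq> x" "z \<in> F" | "z \<noteq> x" "z \<notin> F" by blast
      then show ?thesis
      proof cases
        case 1
        have "nat (max 0 (\<kappa> x) + 1) = Suc (nat (\<kappa> x))" by auto
        then show ?thesis using 1 xF by (simp add: a_def b_def)
      next
        case 2
        then have "p z = x" using F by auto
        moreover have "nat (max 1 (\<kappa> z)) = Suc (nat (\<kappa> z - 1))" by auto
        ultimately show ?thesis using 2 by (simp add: a_def b_def)
      next
        case 3
        then have "p z \<noteq> x" using that F by auto
        then show ?thesis using 3 by (simp add: a_def b_def)
      qed
    qed
    then have "(\<Prod>z\<in>?J. c z ^ nat (b z)) * (\<Prod>z\<in>?J. if z = x then c z else 1)
        = (\<Prod>z\<in>?J. c z ^ nat (a z)) * (\<Prod>z\<in>?J. if z \<in> F then c z else 1)"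
      unfolding prod.distrib[symmetric] by (rule prod.cong[OF refl])
    ultimately show ?thesis by (simp only:)
  qed
  ultimately show ?thesis
    using J F by (simp only: cyl finite_insert finite_Un)
qed

text \<open>Two measures are compared on cylinders: the image, under adding 1 at \<open>x\<close>,
  of \<open>\<mu>\<close> restricted to a positive increment at \<open>x\<close>, and
  \<open>\<mu>\<close> restricted to positive increments at all children. Their equality is the
  limit of the finite balance along the children, by the flow equation.\<close>

lemma flow_invar_site:
  assumes "prob_space \<mu>" and sets [simp]: "sets \<mu> = sets gradient_algebra"
    and AE: "AE h in \<mu>. h \<in> M"
    and cyl: "\<And>J k. finite J \<Longrightarrow> measure \<mu> (cyl J k) = (\<Prod>x\<in>J. wt (f x) ^ nat (k x))"
    and flow: "f x = (\<Sum>\<^sub>\<infinity>z\<in>{z. p z = x}. f z)"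
  shows "invar \<mu> (site x)"
proof -
  interpret prob_space \<mu> by fact
  have [measurable_cong]: "sets \<mu> = sets gradient_algebra" by simp
  have space [simp]: "space \<mu> = UNIV" using sets_eq_imp_space_eq[OF sets] by simp
  let ?t = "translate (site x)"
  let ?K = "{z. p z = x}"
  let ?F = "\<lambda>n. {z. p z = x \<and> to_nat z < n}"
  let ?N1 = "distr (density \<mu> (indicator (cyl {x} (\<lambda>_. 1)))) gradient_algebra ?t"
  let ?N2 = "density \<mu> (indicator (cyl ?K (\<lambda>_. 1)))"
  have fin: "finite (?F n)" for n
    by (rule finite_imageD[of to_nat]) (auto intro: finite_subset[of _ "{..<n}"] inj_onI)
  have N1: "emeasure ?N1 D = measure \<mu> (cyl {x} (\<lambda>_. 1) \<inter> ?t -` D)" if "D \<in> sets gradient_algebra" for D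
    using that by (subst emeasure_distr) (auto simp: emeasure_restricted translate_vimage_sets cyl_sets emeasure_eq_measure)
  have N2: "emeasure ?N2 D = measure \<mu> (cyl ?K (\<lambda>_. 1) \<inter> D)" if "D \<in> sets gradient_algebra" for D
    using that by (subst emeasure_restricted) (auto simp: cyl_sets emeasure_eq_measure)
  have lim: "(\<lambda>n. \<Prod>z\<in>?F n. wt (f z)) \<longlonglongrightarrow> wt (f x)"
    using children_product_tendsto[where x = x and f = f] by (simp add: flow)
  have eq: "measure \<mu> (cyl ?K (\<lambda>_. 1) \<inter> cyl J k) = measure \<mu> (cyl {x} (\<lambda>_. 1) \<inter> ?t -` cyl J k)"
    if J: "finite J" for J k
  proof (cases "wt (f x) = 0")
    case False
    obtain N where N: "\<And>z. z \<in> J \<Longrightarrow> to_nat z < N"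
      using finite_nat_set_iff_bounded[of "to_nat ` J"] J by auto
    have "measure \<mu> (cyl (?F n) (\<lambda>_. 1) \<inter> cyl J k) * wt (f x) =
        measure \<mu> (cyl {x} (\<lambda>_. 1) \<inter> ?t -` cyl J k) * (\<Prod>z\<in>?F n. wt (f z))" if "N \<le> n" for n
    proof (rule site_cylinder_balance[OF J fin _ _ \<open>prob_space \<mu>\<close> sets AE cyl])
      show "J \<inter> ?K \<subseteq> ?F n" using N that by (auto intro: less_le_trans)
    qed auto
    then have "eventually (\<lambda>n. measure \<mu> (cyl {x} (\<lambda>_. 1) \<inter> ?t -` cyl J k) * (\<Prod>z\<in>?F n. wt (f z)) =
        measure \<mu> (cyl (?F n) (\<lambda>_. 1) \<inter> cyl J k) * wt (f x)) sequentially"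
      by (auto intro!: eventually_sequentiallyI[of N])
    moreover have "(\<lambda>n. measure \<mu> (cyl {x} (\<lambda>_. 1) \<inter> ?t -` cyl J k) * (\<Prod>z\<in>?F n. wt (f z)))
        \<longlonglongrightarrow> measure \<mu> (cyl {x} (\<lambda>_. 1) \<inter> ?t -` cyl J k) * wt (f x)"
      by (intro tendsto_intros lim)
    ultimately have "(\<lambda>n. measure \<mu> (cyl (?F n) (\<lambda>_. 1) \<inter> cyl J k) * wt (f x))
        \<longlonglongrightarrow> measure \<mu> (cyl {x} (\<lambda>_. 1) \<inter> ?t -` cyl J k) * wt (f x)"
      by (rule Lim_transform_eventually[rotated])
    moreover have "(\<lambda>n. measure \<mu> (cyl (?F n) (\<lambda>_. 1) \<inter> cyl J k) * wt (f x))
        \<longlonglongrightarrow> measure \<mu> (cyl ?K (\<lambda>_. 1) \<inter> cyl J k) * wt (f x)"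
      by (intro tendsto_intros children_measure_tendsto finite_measure_axioms sets cyl_sets)
    ultimately have "measure \<mu> (cyl {x} (\<lambda>_. 1) \<inter> ?t -` cyl J k) * wt (f x)
        = measure \<mu> (cyl ?K (\<lambda>_. 1) \<inter> cyl J k) * wt (f x)"
      by (rule LIMSEQ_unique)
    then show ?thesis using False by simp
  next
    \<comment> \<open>Here the common factor cannot be cancelled. Instead both sides are null: one
      is bounded by the probability of a positive increment at \<open>x\<close>, the other by the
      products over finitely many children, which tend to 0.\<close>
    case True
    have "measure \<mu> (cyl {x} (\<lambda>_. 1) \<inter> ?t -` cyl J k) \<le> measure \<mu> (cyl {x} (\<lambda>_. 1))"
      by (intro finite_measure_mono) (auto simp: cyl_sets)
    also have "\<dots> = 0" using True by (simp add: cyl)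
    finally have 1: "measure \<mu> (cyl {x} (\<lambda>_. 1) \<inter> ?t -` cyl J k) = 0" by (simp add: measure_le_0_iff)
    have "measure \<mu> (cyl ?K (\<lambda>_. 1) \<inter> cyl J k) \<le> measure \<mu> (cyl (?F n) (\<lambda>_. 1))" for n
      by (intro finite_measure_mono) (auto simp: cyl_sets, auto simp: cyl_def)
    then have "measure \<mu> (cyl ?K (\<lambda>_. 1) \<inter> cyl J k) \<le> (\<Prod>z\<in>?F n. wt (f z))" for n
      unfolding cyl[OF fin] by simp
    then have "measure \<mu> (cyl ?K (\<lambda>_. 1) \<inter> cyl J k) \<le> wt (f x)"
      by (intro LIMSEQ_le_const[OF lim]) auto
    then show ?thesis using 1 True by (simp add: measure_le_0_iff)
  qed
  have "?N1 = ?N2"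
  proof (rule measure_eqI_cyl)
    show "finite_measure ?N1"
      by standard (use N1[OF sets.top[of gradient_algebra, unfolded space_gradient]] in simp)
  qed (use eq in \<open>simp_all add: N1 N2 cyl_sets\<close>)
  show ?thesis
    unfolding invar_def
  proof (intro ballI impI)
    fix A :: "('v \<Rightarrow> int) set"
    assume A: "A \<in> sets gradient_algebra" "A \<subseteq> M" "?t -` A \<subseteq> M"
    have "?t -` A \<subseteq> cyl {x} (\<lambda>_. 1)"
      using A translate_site_M by blast
    then have "emeasure \<mu> (?t -` A) = emeasure ?N1 A"
      using A by (simp add: N1 emeasure_eq_measure Int_absorb1)
    moreover have "A \<subseteq> cyl ?K (\<lambda>_. 1)"
    proof
      fix h assume "h \<in> A"
      then have "?t (translate (\<lambda>v. - site x v) h) \<in> A" by simp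
      then have "translate (\<lambda>v. - site x v) h \<in> M" using A by blast
      from translate_site_children[OF this, of x] show "h \<in> cyl ?K (\<lambda>_. 1)" by simp
    qed
    then have "emeasure \<mu> A = emeasure ?N2 A"
      using A by (simp add: N2 emeasure_eq_measure Int_absorb1)
    ultimately show "emeasure \<mu> (?t -` A) = emeasure \<mu> A"
      using \<open>?N1 = ?N2\<close> by simp
  qed
qed

text \<open>Unit steps may be composed only if the intermediate configurations stay in
  \<open>M\<close>, so the order matters: the first step is made at some \<open>x\<close> in
  \<open>N\<close> whose parent is not in \<open>N\<close>. As the final configuration is monotone
  and \<open>p x\<close> is never raised, the increment at \<open>x\<close> is at least 1 at the
  start.\<close>

lemma invar_multiset:
  assumes site: "\<And>x. invar \<mu> (site x)"
  shows "invar \<mu> (\<lambda>v. int (count N v))"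
proof (induction "size N" arbitrary: N)
  case 0
  then have "N = {#}" by simp
  then show ?case by (simp add: invar_def vimage_def)
next
  case (Suc n)
  then obtain v where "v \<in># N" by (cases N) auto
  \<comment> \<open>Climbing from \<open>v\<close> leaves the finite support of \<open>N\<close>;
    the last vertex before that is the required \<open>x\<close>.\<close>
  obtain m where m: "(p ^^ m) v \<notin> set_mset N" "\<And>i. i < m \<Longrightarrow> (p ^^ i) v \<in> set_mset N"
    using funpow_escapes[of "set_mset N" v] exists_least_iff[of "\<lambda>m. (p ^^ m) v \<notin> set_mset N"] by auto
  then have "m \<noteq> 0" using \<open>v \<in># N\<close> by (metis funpow_0)
  define x where "x = (p ^^ (m - 1)) v"
  have "p x = (p ^^ Suc (m - 1)) v" by (simp add: x_def)
  then have x: "x \<in># N" "p x \<notin># N"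
    using m \<open>m \<noteq> 0\<close> by (simp_all add: x_def)
  then obtain N' where N: "N = add_mset x N'" by (meson multi_member_split)
  have N_site: "int (count N v) = int (count N' v) + site x v" for v
    by (auto simp: N site_def)
  show ?case
    unfolding invar_def
  proof (intro ballI impI)
    fix A :: "('v \<Rightarrow> int) set"
    let ?B = "translate (\<lambda>v. int (count N v)) -` A"
    let ?B' = "translate (\<lambda>v. int (count N' v)) -` A"
    assume A: "A \<in> sets gradient_algebra" "A \<subseteq> M" "?B \<subseteq> M"
    have B: "translate (site x) -` ?B' = ?B"
      by (simp add: translate_vimage N_site)
    have B': "?B' \<subseteq> M"
    proof
      fix g assume g: "g \<in> ?B'"
      define h where "h = translate (\<lambda>v. - site x v) g"
      have gh: "g = translate (site x) h" by (simp add: h_def)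
      have hN: "translate (\<lambda>v. int (count N v)) h \<in> A"
        using g by (simp add: gh N_site)
      then have "h \<in> M" using A by auto
      have "0 \<le> incr (translate (\<lambda>v. int (count N v)) h) x"
        using hN A by (auto simp: M_iff)
      moreover have "count N (p x) = 0" "1 \<le> int (count N x)"
        using x by (simp_all add: not_in_iff Suc_le_eq flip: count_greater_zero_iff)
      ultimately have "1 \<le> incr h x" unfolding incr_translate by linarith
      then show "g \<in> M"
        unfolding gh using translate_site_M[OF \<open>h \<in> M\<close>] by (simp add: cyl_def)
    qed
    have "emeasure \<mu> ?B = emeasure \<mu> ?B'"
      using invarD[OF site[of x] translate_vimage_sets[OF A(1)] B'] A(3) by (simp only: B)
    also have "\<dots> = emeasure \<mu> A"
      using Suc A B' N by (intro invarD[of \<mu>]) auto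
    finally show "emeasure \<mu> ?B = emeasure \<mu> A" .
  qed
qed

text \<open>The positive and the negative part of \<open>d\<close> are treated separately. The
  intermediate configuration is the pointwise maximum of \<open>h\<close> and \<open>h - d\<close>,
  and a maximum of two monotone functions is monotone.\<close>

lemma invar_finite:
  assumes site: "\<And>x. invar \<mu> (site x)" and fin: "finite {v. d v \<noteq> 0}"
  shows "invar \<mu> d"
proof -
  have mset: "invar \<mu> (\<lambda>v. max 0 (f v))" if "finite {v. f v \<noteq> 0}" for f :: "'v \<Rightarrow> int"
  proof -
    have "finite {v. 0 < nat (f v)}" using that by (rule finite_subset[rotated]) auto
    then have "count (Abs_multiset (\<lambda>v. nat (f v))) = (\<lambda>v. nat (f v))"
      by (rule count_Abs_multiset)
    moreover have "(\<lambda>v. int (nat (f v))) = (\<lambda>v. max 0 (f v))" by auto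
    ultimately show ?thesis
      using invar_multiset[OF site, of "Abs_multiset (\<lambda>v. nat (f v))"] by simp
  qed
  have up: "invar \<mu> (\<lambda>v. max 0 (d v))" using fin by (rule mset)
  have down: "invar \<mu> (\<lambda>v. max 0 (- d v))" using fin by (intro mset) simp
  show ?thesis
    unfolding invar_def
  proof (intro ballI impI)
    fix A :: "('v \<Rightarrow> int) set"
    assume A: "A \<in> sets gradient_algebra" "A \<subseteq> M" "translate d -` A \<subseteq> M"
    let ?A = "translate (\<lambda>v. - max 0 (- d v)) -` A"
    have A1: "translate (\<lambda>v. max 0 (- d v)) -` ?A = A"
      by (simp add: translate_vimage) (simp add: vimage_def)
    have "(\<lambda>v. - max 0 (- d v) + max 0 (d v)) = d" by auto
    then have A2: "translate (\<lambda>v. max 0 (d v)) -` ?A = translate d -` A"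
      by (simp add: translate_vimage)
    have "?A \<subseteq> M"
    proof
      fix g assume "g \<in> ?A"
      define h where "h = translate (\<lambda>v. - max 0 (- d v)) g"
      have "h \<in> A" using \<open>g \<in> ?A\<close> by (simp add: h_def)
      then have "translate d (translate (\<lambda>v. - d v) h) \<in> A" by simp
      then have "translate (\<lambda>v. - d v) h \<in> M" "h \<in> M" using A \<open>h \<in> A\<close> by auto
      then have "h y \<le> h (p y)" "h y - d y \<le> h (p y) - d (p y)" for y
        using M_le[of _ y] by (fastforce simp: translate_def)+
      moreover have "g y = max (h y) (h y - d y)" for y
        by (auto simp: h_def translate_def)
      ultimately have "g y \<le> g (p y)" for y
        by (simp add: max.coboundedI1 max.coboundedI2)
      then show "g \<in> M" by (simp add: M_iff incr_def)
    qed
    then have "emeasure \<mu> (translate d -` A) = emeasure \<mu> ?A"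
      using invarD[OF up, of ?A] A A2 by (simp add: translate_vimage_sets)
    also have "\<dots> = emeasure \<mu> A"
      using invarD[OF down, of ?A] A A1 \<open>?A \<subseteq> M\<close> by (simp add: translate_vimage_sets)
    finally show "emeasure \<mu> (translate d -` A) = emeasure \<mu> A" .
  qed
qed

end

subsection \<open>Tail events\<close>

lemma tail_translate:
  assumes "A \<in> tail_sets" "finite {v. d v \<noteq> 0}"
  shows "translate d -` A = A"
proof -
  have "A \<in> sigma_sets UNIV {{h. h y \<in> B} | y B. y \<notin> {v. d v \<noteq> 0}}"
    using assms by (auto simp: tail_sets_def)
  then show ?thesis
  proof induction
    case (Basic a)
    then show ?case by (auto simp: translate_def)
  next
    case (Compl a)
    then show ?case by (simp add: vimage_Diff)
  next
    case (Union a)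
    then show ?case by (simp add: vimage_UN)
  qed simp
qed

text \<open>Setting the heights on \<open>\<Lambda>\<close> to 0 is a finite modification of each
  \<open>h\<close>, hence preserves \<open>A\<close>, and its result depends only on the heights
  outside \<open>\<Lambda>\<close>.\<close>

lemma invariant_gradient_tail:
  assumes A: "A \<in> sets gradient_algebra" and inv: "\<And>d. finite {v. d v \<noteq> 0} \<Longrightarrow> translate d -` A = A"
  shows "A \<in> gradient_tail_sets"
  unfolding gradient_tail_sets_def tail_sets_def
proof (intro IntI INT_I A)
  fix \<Lambda> :: "'a set" assume "\<Lambda> \<in> {\<Lambda>. finite \<Lambda>}"
  let ?G = "{{h. h y \<in> B} | y B. y \<notin> \<Lambda>} :: ('a \<Rightarrow> int) set set"
  let ?N = "sigma UNIV ?G"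
  have [simp]: "space ?N = UNIV" "sets ?N = sigma_sets UNIV ?G"
    by (simp_all add: space_measure_of_conv)
  define z where "z = (\<lambda>(h :: 'a \<Rightarrow> int) v. if v \<in> \<Lambda> then 0 else h v)"
  have z_meas: "(\<lambda>h. z h y) \<in> measurable ?N (count_space UNIV)" for y
  proof (cases "y \<in> \<Lambda>")
    case False
    show ?thesis
    proof (rule measurableI)
      fix B :: "int set"
      have "{h. h y \<in> B} \<in> sigma_sets UNIV ?G" using False by (intro sigma_sets.Basic) blast
      then show "(\<lambda>h. z h y) -` B \<inter> space ?N \<in> sets ?N" using False by (simp add: z_def vimage_def)
    qed simp
  qed (simp add: z_def)
  have "z \<in> measurable ?N gradient_algebra"
  proof (rule measurable_into_gradient)
    fix y y'
    have "(\<lambda>h. z h y + (- z h y')) \<in> measurable ?N (count_space UNIV)"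
      by (intro measurable_int_add z_meas measurable_compose[OF z_meas, of uminus]) simp
    then show "(\<lambda>h. z h y - z h y') \<in> measurable ?N (count_space UNIV)" by simp
  qed
  then have "z -` A \<in> sigma_sets UNIV ?G"
    using measurable_sets[of z ?N gradient_algebra A] A by simp
  also have "z -` A = A"
  proof -
    have "z h \<in> A \<longleftrightarrow> h \<in> A" for h
    proof -
      \<comment> \<open>The modification depends on \<open>h\<close>, which is harmless because
        \<open>A\<close> is invariant under every finite one.\<close>
      let ?d = "\<lambda>v. if v \<in> \<Lambda> then - h v else 0"
      have "finite {v. ?d v \<noteq> 0}" using \<open>\<Lambda> \<in> _\<close> by (auto intro: finite_subset)
      moreover have "z h = translate ?d h" by (auto simp: z_def translate_def)
      ultimately show ?thesis using inv[of ?d] by auto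
    qed
    then show ?thesis by auto
  qed
  finally show "A \<in> sigma_sets UNIV ?G" .
qed

text \<open>Subtracting the finite number \<open>c\<close> times the mass of \<open>Q\<close> leaves
  a nonpositive integral of \<open>f - c\<close> over \<open>Q\<close>, where the integrand is
  strictly positive.\<close>

lemma density_concentration:
  assumes "finite_measure \<mu>" and [measurable]: "f \<in> borel_measurable \<mu>" "Q \<in> sets \<mu>"
    and gt: "\<And>x. x \<in> Q \<Longrightarrow> ennreal c < f x" and "0 \<le> c"
    and le: "emeasure (density \<mu> f) Q \<le> ennreal c * emeasure \<mu> Q"
  shows "emeasure \<mu> Q = 0"
proof -
  interpret finite_measure \<mu> by fact
  have "emeasure (density \<mu> f) Q = (\<integral>\<^sup>+x. f x * indicator Q x \<partial>\<mu>)"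
    by (simp add: emeasure_density)
  also have "\<dots> = (\<integral>\<^sup>+x. ennreal c * indicator Q x + (f x - ennreal c) * indicator Q x \<partial>\<mu>)"
    using gt by (intro nn_integral_cong) (auto simp: indicator_def add_diff_inverse_ennreal less_imp_le)
  also have "\<dots> = ennreal c * emeasure \<mu> Q + (\<integral>\<^sup>+x. (f x - ennreal c) * indicator Q x \<partial>\<mu>)"
    by (subst nn_integral_add) (auto simp: nn_integral_cmult_indicator)
  finally have *: "ennreal c * emeasure \<mu> Q + (\<integral>\<^sup>+x. (f x - ennreal c) * indicator Q x \<partial>\<mu>) \<le> ennreal c * emeasure \<mu> Q + 0"
    using le by simp
  have "ennreal c * emeasure \<mu> Q \<noteq> \<infinity>"
    by (simp add: emeasure_eq_measure ennreal_mult_eq_top_iff)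
  then have "(\<integral>\<^sup>+x. (f x - ennreal c) * indicator Q x \<partial>\<mu>) \<le> 0"
    using * by (subst (asm) ennreal_add_left_cancel_le) auto
  then have "(\<integral>\<^sup>+x. (f x - ennreal c) * indicator Q x \<partial>\<mu>) = 0" by simp
  then have "AE x in \<mu>. (f x - ennreal c) * indicator Q x = 0"
    by (subst (asm) nn_integral_0_iff_AE) auto
  then have "AE x in \<mu>. x \<notin> Q"
  proof eventually_elim
    case (elim x)
    show ?case
    proof
      assume "x \<in> Q"
      then have "f x - ennreal c = 0" using elim by simp
      then show False using gt[OF \<open>x \<in> Q\<close>] by (simp add: diff_eq_0_iff_ennreal not_le[symmetric])
    qed
  qed
  then show ?thesis
    using sets.sets_into_space[OF assms(3)] by (subst (asm) AE_iff_measurable[of Q]) auto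
qed

context parent_map
begin

subsection \<open>Flow measures are extremal\<close>

lemma flow_tail_trivial:
  assumes "prob_space \<mu>" and sets [simp]: "sets \<mu> = sets gradient_algebra"
    and AE: "AE h in \<mu>. h \<in> M"
    and inv: "\<And>d. finite {v. d v \<noteq> 0} \<Longrightarrow> invar \<mu> d"
    and mem: "\<And>x. memoryless \<mu> x (c x)"
    and A: "A \<in> gradient_tail_sets"
  shows "measure \<mu> A = 0 \<or> measure \<mu> A = 1"
proof -
  interpret prob_space \<mu> by fact
  have [measurable_cong]: "sets \<mu> = sets gradient_algebra" by simp
  have space [simp]: "space \<mu> = UNIV" using sets_eq_imp_space_eq[OF sets] by simp
  have A_sets: "A \<in> sets gradient_algebra" and A_tail: "A \<in> tail_sets"
    using A by (auto simp: gradient_tail_sets_def)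
  have cA_sets: "- A \<in> sets gradient_algebra"
    using sets.compl_sets[OF A_sets] by (simp add: Compl_eq_Diff_UNIV)
  have [measurable]: "A \<in> sets \<mu>" "- A \<in> sets \<mu>" using A_sets cA_sets by auto
  have restr: "emeasure (density \<mu> (indicator B)) C = emeasure \<mu> (B \<inter> C)"
    "measure (density \<mu> (indicator B)) C = measure \<mu> (B \<inter> C)"
    if "B \<in> sets gradient_algebra" "C \<in> sets gradient_algebra" for B C
    using that by (auto simp: emeasure_restricted measure_def)
  have fin: "finite_measure (density \<mu> (indicator B))" if "B \<in> sets gradient_algebra" for B
    by standard (use restr(1)[OF that sets.top[of gradient_algebra, unfolded space_gradient]] in simp)
  \<comment> \<open>The restriction of \<open>\<mu>\<close> to an invariant \<open>B\<close> is
    again invariant, so domination bounds the part of \<open>B\<close> that the ray moves into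
    \<open>- B\<close> by the restricted mass of \<open>- B\<close>, which is 0.\<close>
  have stable: "measure \<mu> (B \<inter> translate (ray x) -` (- B \<inter> M)) = 0"
    if B: "B \<in> sets gradient_algebra" "- B \<in> sets gradient_algebra" "\<And>d. finite {v. d v \<noteq> 0} \<Longrightarrow> translate d -` B = B" for B x
  proof -
    have "measure (density \<mu> (indicator B)) (translate (ray x) -` (- B \<inter> M)) \<le> measure (density \<mu> (indicator B)) (- B)"
    proof (rule ray_domination[OF fin])
      fix d :: "'v \<Rightarrow> int" assume d: "finite {v. d v \<noteq> 0}"
      show "invar (density \<mu> (indicator B)) d"
        unfolding invar_def
      proof (intro ballI impI)
        fix C :: "('v \<Rightarrow> int) set"
        assume C: "C \<in> sets gradient_algebra" "C \<subseteq> M" "translate d -` C \<subseteq> M"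
        have "B \<inter> translate d -` C = translate d -` (B \<inter> C)" using B(3)[OF d] by blast
        moreover have "emeasure \<mu> (translate d -` (B \<inter> C)) = emeasure \<mu> (B \<inter> C)"
          using B C by (intro invarD[OF inv[OF d]]) auto
        ultimately show "emeasure (density \<mu> (indicator B)) (translate d -` C) = emeasure (density \<mu> (indicator B)) C"
          using B C by (simp add: restr translate_vimage_sets)
      qed
    qed (use B in simp_all)
    then show ?thesis
      using B by (simp add: restr translate_vimage_sets M_sets sets.Int measure_le_0_iff)
  qed
  have tA: "translate d -` A = A" if "finite {v. d v \<noteq> 0}" for d
    using A_tail that by (rule tail_translate)
  then have tcA: "translate d -` (- A) = - A" if "finite {v. d v \<noteq> 0}" for d
    using that by (simp add: vimage_Compl)
  let ?\<rho> = "density \<mu> (indicator A)"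
  have "memoryless ?\<rho> x (c x)" for x
    unfolding memoryless_def
  proof
    fix C :: "('v \<Rightarrow> int) set" assume C: "C \<in> sets gradient_algebra"
    let ?t = "translate (ray x)"
    have null: "AE h in \<mu>. h \<notin> X" if "X \<in> sets gradient_algebra" "measure \<mu> X = 0" for X
      using that by (subst AE_iff_measurable[of X]) (auto simp: emeasure_eq_measure)
    \<comment> \<open>Stability of \<open>A\<close> and of its complement together make restriction
      to \<open>A\<close> commute almost surely with the shift.\<close>
    have "AE h in \<mu>. h \<notin> A \<inter> ?t -` (- A \<inter> M)"
      using A_sets cA_sets stable[OF A_sets cA_sets tA]
      by (intro null sets.Int translate_vimage_sets M_sets)
    moreover have "AE h in \<mu>. h \<notin> - A \<inter> ?t -` (- (- A) \<inter> M)"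
      using A_sets cA_sets stable[of "- A" x] tcA
      by (intro null sets.Int translate_vimage_sets M_sets) simp_all
    ultimately have "AE h in \<mu>. h \<in> A \<inter> ?t -` (C \<inter> M) \<longleftrightarrow> h \<in> ?t -` (A \<inter> C \<inter> M)"
      by eventually_elim auto
    then have "measure \<mu> (A \<inter> ?t -` (C \<inter> M)) = measure \<mu> (?t -` (A \<inter> C \<inter> M))"
      using A_sets C by (intro measure_eq_AE) (auto intro!: sets.Int translate_vimage_sets M_sets)
    also have "\<dots> = c x * measure \<mu> (A \<inter> C)"
      using mem[of x] sets.Int[OF A_sets C] unfolding memoryless_def by blast
    finally show "measure ?\<rho> (?t -` (C \<inter> M)) = c x * measure ?\<rho> C"
      using A_sets C by (simp add: restr translate_vimage_sets M_sets sets.Int)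
  qed
  moreover have "AE h in ?\<rho>. h \<in> M"
    using AE by (subst AE_density) auto
  ultimately have rho: "measure ?\<rho> (cyl J k) = measure ?\<rho> UNIV * (\<Prod>x\<in>J. c x ^ nat (k x))" if "finite J" for J k
    using fin[OF A_sets] that by (intro memoryless_cyl) auto
  have mu: "measure \<mu> (cyl J k) = measure \<mu> UNIV * (\<Prod>x\<in>J. c x ^ nat (k x))" if "finite J" for J k
    using that by (intro memoryless_cyl finite_measure_axioms sets AE mem)
  have U: "UNIV \<in> sets (gradient_algebra :: ('v \<Rightarrow> int) measure)"
    using sets.top[of gradient_algebra] by simp
  have UNIV: "measure ?\<rho> UNIV = prob A" "prob UNIV = 1"
    using A_sets U prob_space by (simp_all add: restr)
  have "?\<rho> = scale_measure (ennreal (prob A)) \<mu>"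
  proof (rule measure_eqI_cyl)
    fix J :: "'v set" and k :: "'v \<Rightarrow> int" assume J: "finite J"
    interpret R: finite_measure ?\<rho> by (rule fin[OF A_sets])
    show "emeasure ?\<rho> (cyl J k) = emeasure (scale_measure (ennreal (prob A)) \<mu>) (cyl J k)"
    proof -
      have "measure ?\<rho> (cyl J k) = prob A * prob (cyl J k)"
        using rho[OF J, of k] mu[OF J, of k] by (simp add: UNIV)
      then show ?thesis by (simp add: R.emeasure_eq_measure emeasure_eq_measure ennreal_mult)
    qed
  qed (use fin[OF A_sets] in auto)
  then have "emeasure ?\<rho> (- A) = ennreal (prob A) * emeasure \<mu> (- A)" by simp
  moreover have "emeasure ?\<rho> (- A) = 0"
    using A_sets cA_sets by (simp add: restr)
  moreover have "prob (- A) = 1 - prob A"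
    using prob_compl[of A] A_sets by (simp add: Compl_eq_Diff_UNIV)
  ultimately have "prob A * (1 - prob A) = 0"
    by (simp add: emeasure_eq_measure flip: ennreal_mult)
  then show ?thesis by simp
qed

subsection \<open>Extremal measures are flow measures\<close>

lemma extremal_memoryless:
  assumes "prob_space \<mu>" and sets [simp]: "sets \<mu> = sets gradient_algebra"
    and AE: "AE h in \<mu>. h \<in> M"
    and inv: "\<And>d. finite {v. d v \<noteq> 0} \<Longrightarrow> invar \<mu> d"
    and trivial: "\<And>A. A \<in> gradient_tail_sets \<Longrightarrow> measure \<mu> A = 0 \<or> measure \<mu> A = 1"
  shows "\<exists>c. memoryless \<mu> x c"
proof -
  interpret prob_space \<mu> by fact
  have cong [measurable_cong]: "sets \<mu> = sets gradient_algebra" by simp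
  have space [simp]: "space \<mu> = UNIV" using sets_eq_imp_space_eq[OF sets] by simp
  have U: "UNIV \<in> sets (gradient_algebra :: ('v \<Rightarrow> int) measure)"
    using sets.top[of gradient_algebra] by simp
  let ?t = "translate (ray x)"
  define \<nu> where "\<nu> = distr (density \<mu> (indicator (?t -` M))) gradient_algebra ?t"
  have sets_\<nu> [simp]: "sets \<nu> = sets gradient_algebra" and space_\<nu> [simp]: "space \<nu> = UNIV"
    by (simp_all add: \<nu>_def)
  have \<nu>: "emeasure \<nu> D = emeasure \<mu> (?t -` (D \<inter> M))" if "D \<in> sets gradient_algebra" for D
    unfolding \<nu>_def using that
    by (subst emeasure_distr) (auto simp: emeasure_restricted translate_vimage_sets M_sets Int_commute)
  interpret N: finite_measure \<nu>
    by standard (use \<nu>[OF U] in \<open>simp add: emeasure_eq_measure\<close>)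
  have \<nu>_le: "emeasure \<nu> D \<le> emeasure \<mu> D" if "D \<in> sets gradient_algebra" for D
    using ray_domination[OF finite_measure_axioms sets inv that] \<nu>[OF that]
    by (simp add: emeasure_eq_measure)
  have \<nu>_invar: "invar \<nu> d" if d: "finite {v. d v \<noteq> 0}" for d
    unfolding invar_def
  proof (intro ballI impI)
    fix C :: "('v \<Rightarrow> int) set"
    assume C: "C \<in> sets gradient_algebra" "C \<subseteq> M" "translate d -` C \<subseteq> M"
    have "?t -` translate d -` C = translate d -` ?t -` C"
      by (simp add: translate_vimage add.commute)
    moreover have "?t -` C \<subseteq> M" "?t -` translate d -` C \<subseteq> M"
      using C translate_ray_M by blast+
    ultimately have "emeasure \<mu> (?t -` translate d -` C) = emeasure \<mu> (?t -` C)"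
      using invarD[OF inv[OF d], of "?t -` C"] C by (simp add: translate_vimage_sets)
    then show "emeasure \<nu> (translate d -` C) = emeasure \<nu> C"
      using C by (simp add: \<nu> translate_vimage_sets Int_absorb2)
  qed
  have "absolutely_continuous \<mu> \<nu>"
    unfolding absolutely_continuous_def
  proof
    fix D assume "D \<in> null_sets \<mu>"
    then show "D \<in> null_sets \<nu>" using \<nu>_le[of D] by (auto simp: null_sets_def)
  qed
  then obtain f where f [measurable]: "f \<in> borel_measurable \<mu>" and dens: "density \<mu> f = \<nu>"
    using Radon_Nikodym_finite_measure[OF N.finite_measure_axioms] by auto
  have [measurable]: "f \<in> borel_measurable gradient_algebra"
    using f measurable_cong_sets[OF cong refl] by blast
  \<comment> \<open>A constant density with respect to a probability measure can only be the total
    mass of \<open>\<nu>\<close>.\<close>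
  define c where "c = measure \<nu> UNIV"
  have c: "0 \<le> c" by (simp add: c_def)
  define A where "A = {h. ennreal c < f h}"
  have A_sets: "A \<in> sets gradient_algebra"
  proof -
    have "{h \<in> space gradient_algebra. ennreal c < f h} \<in> sets gradient_algebra" by measurable
    then show ?thesis by (simp add: A_def)
  qed
  let ?F = "{d :: 'v \<Rightarrow> int. finite {v. d v \<noteq> 0}}"
  \<comment> \<open>\<open>A'\<close> asks that some finite modification of \<open>h\<close> is
    monotone and that every monotone one lies in \<open>A\<close>. It is exactly invariant, whereas
    \<open>A\<close> is so only up to null sets and within \<open>M\<close>.\<close>
  define A' where "A' = (\<Union>d\<in>?F. translate d -` M) \<inter> (\<Inter>d\<in>?F. translate d -` (A \<union> - M))"
  have cM: "- M \<in> sets gradient_algebra"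
    using sets.compl_sets[OF M_sets] by (simp add: Compl_eq_Diff_UNIV)
  have zero: "(\<lambda>_. 0) \<in> ?F" by simp
  have nonempty: "?F \<noteq> {}"
    by (rule notI) (use zero in \<open>simp only: empty_iff\<close>)
  have A'_sets: "A' \<in> sets gradient_algebra"
    unfolding A'_def
  proof (intro sets.Int sets.countable_UN' sets.countable_INT' countable_finite_support nonempty image_subsetI)
    show "translate d -` M \<in> sets gradient_algebra" for d
      using M_sets by (rule translate_vimage_sets)
    show "translate d -` (A \<union> - M) \<in> sets gradient_algebra" for d
      using sets.Un[OF A_sets cM] by (rule translate_vimage_sets)
  qed
  have "translate d -` A' = A'" if d: "finite {v. d v \<noteq> 0}" for d
  proof -
    have F_eq: "(\<lambda>e v. e v + d v) ` ?F = ?F"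
    proof (intro equalityI subsetI)
      fix e assume "e \<in> (\<lambda>e v. e v + d v) ` ?F"
      then obtain e' where e: "e' \<in> ?F" "e = (\<lambda>v. e' v + d v)" by blast
      have "{v. e v \<noteq> 0} \<subseteq> {v. e' v \<noteq> 0} \<union> {v. d v \<noteq> 0}" using e by auto
      then show "e \<in> ?F" using e d finite_subset by auto
    next
      fix e assume e: "e \<in> ?F"
      have "{v. e v - d v \<noteq> 0} \<subseteq> {v. e v \<noteq> 0} \<union> {v. d v \<noteq> 0}" by auto
      then have "(\<lambda>v. e v - d v) \<in> ?F" using e d finite_subset by auto
      then show "e \<in> (\<lambda>e v. e v + d v) ` ?F" by (intro image_eqI[of _ _ "\<lambda>v. e v - d v"]) auto
    qed
    have "translate d -` A' = (\<Union>e\<in>?F. translate (\<lambda>v. e v + d v) -` M) \<inter> (\<Inter>e\<in>?F. translate (\<lambda>v. e v + d v) -` (A \<union> - M))"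
      by (auto simp: A'_def)
    also have "\<dots> = (\<Union>e\<in>(\<lambda>e v. e v + d v) ` ?F. translate e -` M) \<inter> (\<Inter>e\<in>(\<lambda>e v. e v + d v) ` ?F. translate e -` (A \<union> - M))"
      by auto
    also have "\<dots> = A'" unfolding F_eq A'_def ..
    finally show ?thesis .
  qed
  then have "A' \<in> gradient_tail_sets"
    using A'_sets by (intro invariant_gradient_tail)
  moreover have "measure \<mu> A' = measure \<mu> A"
  proof (rule measure_eq_AE)
    \<comment> \<open>\<open>?Q\<close> is the part of \<open>A\<close> that \<open>d\<close>
      carries out of \<open>A\<close> inside \<open>M\<close>, and \<open>?R\<close> is its image.
      By invariance both have the same mass under \<open>\<mu>\<close> and under
      \<open>\<nu>\<close>, but the density exceeds \<open>c\<close> on \<open>?Q\<close> and not on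
      \<open>?R\<close>.\<close>
    have null: "AE h in \<mu>. h \<notin> (A \<inter> M) \<inter> translate d -` (M - A)" if "d \<in> ?F" for d
    proof -
      let ?Q = "(A \<inter> M) \<inter> translate d -` (M - A)"
      let ?R = "translate (\<lambda>v. - d v) -` ?Q"
      have Q: "?Q \<in> sets gradient_algebra"
        using A_sets M_sets by (intro sets.Int translate_vimage_sets sets.Diff)
      have R: "?R \<in> sets gradient_algebra" using Q by (rule translate_vimage_sets)
      have R_sub: "?R \<subseteq> M - A" by auto
      have d': "finite {v. - d v \<noteq> 0}" using that by simp
      have eq: "emeasure K ?R = emeasure K ?Q" if "invar K (\<lambda>v. - d v)" for K
        using R_sub by (intro invarD[OF that Q]) auto
      have "emeasure \<mu> ?Q = 0"
      proof (rule density_concentration[OF finite_measure_axioms f _ _ c])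
        have "emeasure (density \<mu> f) ?R = (\<integral>\<^sup>+h. f h * indicator ?R h \<partial>\<mu>)"
          using R by (intro emeasure_density) auto
        also have "\<dots> \<le> (\<integral>\<^sup>+h. ennreal c * indicator ?R h \<partial>\<mu>)"
        proof (intro nn_integral_mono)
          fix h
          show "f h * indicator ?R h \<le> ennreal c * indicator ?R h"
            using R_sub by (cases "h \<in> ?R") (auto simp: A_def not_less)
        qed
        also have "\<dots> = ennreal c * emeasure \<mu> ?R"
          using R by (intro nn_integral_cmult_indicator) auto
        finally show "emeasure (density \<mu> f) ?Q \<le> ennreal c * emeasure \<mu> ?Q"
          using eq[OF inv[OF d']] eq[OF \<nu>_invar[OF d']] unfolding dens by simp
      qed (use Q in \<open>auto simp: A_def\<close>)
      then show ?thesis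
        using Q by (subst AE_iff_measurable[of ?Q]) auto
    qed
    have "AE h in \<mu>. \<forall>d\<in>?F. h \<notin> (A \<inter> M) \<inter> translate d -` (M - A)"
      using null countable_finite_support by (subst AE_ball_countable) auto
    then show "AE h in \<mu>. h \<in> A' \<longleftrightarrow> h \<in> A"
      using AE
    proof eventually_elim
      case (elim h)
      show ?case
      proof
        assume "h \<in> A'"
        then have "h \<in> (\<Inter>d\<in>?F. translate d -` (A \<union> - M))" unfolding A'_def by (rule IntD2)
        then have "h \<in> translate (\<lambda>_. 0) -` (A \<union> - M)" using zero by (rule INT_D)
        then show "h \<in> A" using elim(2) by simp
      next
        assume "h \<in> A"
        show "h \<in> A'"
          unfolding A'_def
        proof (intro IntI INT_I)
          have "h \<in> translate (\<lambda>_. 0) -` M" using elim(2) by simp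
          then show "h \<in> (\<Union>d\<in>?F. translate d -` M)" by (intro UN_I[OF zero])
          fix d assume "d \<in> ?F"
          then have "h \<notin> (A \<inter> M) \<inter> translate d -` (M - A)" using elim(1) by (rule bspec[rotated])
          then show "h \<in> translate d -` (A \<union> - M)" using \<open>h \<in> A\<close> elim(2) by auto
        qed
      qed
    qed
  qed (use A_sets A'_sets in auto)
  ultimately consider "measure \<mu> A = 1" | "measure \<mu> A = 0"
    using trivial by force
  then have "measure \<mu> A = 0"
  proof cases
    \<comment> \<open>A density above \<open>c\<close> almost everywhere would contradict the total
      mass \<open>c\<close>.\<close>
    case 1
    have "emeasure \<mu> A = 0"
    proof (rule density_concentration[OF finite_measure_axioms f _ _ c])
      have "emeasure \<nu> A \<le> emeasure \<nu> UNIV" using A_sets U by (intro emeasure_mono) auto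
      then show "emeasure (density \<mu> f) A \<le> ennreal c * emeasure \<mu> A"
        using 1 by (simp add: dens emeasure_eq_measure N.emeasure_eq_measure c_def)
    qed (use A_sets in \<open>auto simp: A_def\<close>)
    then show ?thesis by (simp add: measure_def)
  qed
  then have f_le: "AE h in \<mu>. f h \<le> ennreal c"
    using A_sets by (intro AE_iff_measurable[THEN iffD2, of A]) (auto simp: A_def emeasure_eq_measure not_le)
  have le: "measure \<nu> C \<le> c * measure \<mu> C" if C: "C \<in> sets gradient_algebra" for C
  proof -
    have "emeasure \<nu> C = (\<integral>\<^sup>+h. f h * indicator C h \<partial>\<mu>)"
      using C unfolding dens[symmetric] by (intro emeasure_density) auto
    also have "\<dots> \<le> (\<integral>\<^sup>+h. ennreal c * indicator C h \<partial>\<mu>)"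
      by (intro nn_integral_mono_AE, use f_le in eventually_elim) (auto simp: indicator_def)
    also have "\<dots> = ennreal c * emeasure \<mu> C"
      using C by (intro nn_integral_cmult_indicator) auto
    finally show ?thesis
      using c by (simp add: emeasure_eq_measure N.emeasure_eq_measure flip: ennreal_mult)
  qed
  have "measure \<nu> C = c * measure \<mu> C" if C: "C \<in> sets gradient_algebra" for C
  \<comment> \<open>The bounds for \<open>C\<close> and for its complement add up to the total mass
    of \<open>\<nu>\<close>, so neither can be strict.\<close>
  proof (rule antisym[OF le[OF C]])
    have cC: "- C \<in> sets gradient_algebra"
      using sets.compl_sets[OF C] by (simp add: Compl_eq_Diff_UNIV)
    have "measure \<nu> (- C) = c - measure \<nu> C"
      using N.finite_measure_compl[of C] C by (simp add: Compl_eq_Diff_UNIV c_def)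
    moreover have "measure \<mu> (- C) = 1 - measure \<mu> C"
      using prob_compl[of C] C by (simp add: Compl_eq_Diff_UNIV)
    moreover have "c * (1 - measure \<mu> C) = c - c * measure \<mu> C" by (simp add: algebra_simps)
    ultimately show "c * measure \<mu> C \<le> measure \<nu> C"
      using le[OF cC] by simp
  qed
  then have "memoryless \<mu> x c"
    unfolding memoryless_def using \<nu> by (simp add: measure_def)
  then show ?thesis ..
qed

text \<open>With ratio 1 the increment would exceed every integer almost surely. The strict bound is
  what makes the flow values positive.\<close>

lemma memoryless_less_1:
  assumes "prob_space \<mu>" and sets [simp]: "sets \<mu> = sets gradient_algebra"
    and cyl: "\<And>J k. finite J \<Longrightarrow> measure \<mu> (cyl J k) = (\<Prod>x\<in>J. c x ^ nat (k x))"
  shows "0 \<le> c x" "c x < 1"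
proof -
  interpret prob_space \<mu> by fact
  have c: "prob (cyl {x} (\<lambda>_. int n)) = c x ^ n" for n by (simp add: cyl)
  show "0 \<le> c x" using c[of 1] measure_nonneg[of \<mu> "cyl {x} (\<lambda>_. 1)"] by simp
  have "c x \<le> 1" using c[of 1] prob_le_1 by (metis power_one_right)
  moreover have "c x \<noteq> 1"
  proof
    assume "c x = 1"
    have "(\<lambda>n. prob (cyl {x} (\<lambda>_. int n))) \<longlonglongrightarrow> prob (\<Inter>n. cyl {x} (\<lambda>_. int n))"
      by (intro finite_Lim_measure_decseq decseq_SucI) (auto simp: cyl_sets, auto simp: cyl_def)
    moreover have "(\<Inter>n. cyl {x} (\<lambda>_. int n)) = {}"
    proof -
      have "h \<notin> cyl {x} (\<lambda>_. int (nat (incr h x + 1)))" for h by (simp add: cyl_def)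
      then show ?thesis by blast
    qed
    ultimately show False using \<open>c x = 1\<close> by (simp add: c LIMSEQ_const_iff)
  qed
  ultimately show "c x < 1" by simp
qed

lemma flows_iff:
  "\<phi> \<in> flows edges \<longleftrightarrow> \<phi> \<in> extensional edges \<and> (\<forall>x. 0 < \<phi> (x, p x)) \<and>
    (\<forall>x. \<phi> (x, p x) = (\<Sum>\<^sub>\<infinity>z\<in>{z. p z = x}. \<phi> (z, p z)))"
  by (auto simp: flows_def PiE_iff flow_edge_sum)

lemma flow_measure_extremal:
  assumes "\<phi> \<in> flows edges"
  shows "extremal_gradient_gibbs edges (flow_measure edges \<phi>)"
proof -
  let ?\<mu> = "flow_measure edges \<phi>"
  have pos: "\<And>x. 0 < \<phi> (x, p x)" and flow: "\<And>x. \<phi> (x, p x) = (\<Sum>\<^sub>\<infinity>z\<in>{z. p z = x}. \<phi> (z, p z))"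
    using assms unfolding flows_iff by blast+
  have is_flow: "is_flow_measure edges \<phi> ?\<mu>" using pos by (rule flow_measure_is_flow)
  then have prob: "prob_space ?\<mu>" and sets: "sets ?\<mu> = sets gradient_algebra"
    by (simp_all add: is_flow_measure_def)
  note cyl = flow_measure_cyl[OF is_flow pos]
  have AE: "AE h in ?\<mu>. h \<in> M" using prob sets cyl by (rule cyl_AE_M)
  have inv: "invar ?\<mu> d" if "finite {v. d v \<noteq> 0}" for d
    using flow_invar_site[OF prob sets AE cyl flow] that by (rule invar_finite)
  have "gradient_gibbs edges ?\<mu>"
    using prob sets AE inv by (rule invar_gradient_gibbs)
  moreover have "measure ?\<mu> A = 0 \<or> measure ?\<mu> A = 1" if "A \<in> gradient_tail_sets" for A
    using prob sets AE inv cyl_memoryless[OF prob sets AE cyl] that by (rule flow_tail_trivial)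
  ultimately show ?thesis by (simp add: extremal_gradient_gibbs_def)
qed

lemma extremal_is_flow_measure:
  assumes "extremal_gradient_gibbs edges \<mu>"
  shows "\<exists>\<phi>\<in>flows edges. flow_measure edges \<phi> = \<mu>"
proof -
  have gibbs: "gradient_gibbs edges \<mu>" and trivial: "\<And>A. A \<in> gradient_tail_sets \<Longrightarrow> measure \<mu> A = 0 \<or> measure \<mu> A = 1"
    using assms by (auto simp: extremal_gradient_gibbs_def)
  have prob: "prob_space \<mu>" and sets: "sets \<mu> = sets gradient_algebra" and AE: "AE h in \<mu>. h \<in> M"
    using gibbs by (simp_all add: gradient_gibbs_def)
  interpret prob_space \<mu> by fact
  have space: "space \<mu> = UNIV" using sets_eq_imp_space_eq[OF sets] by simp
  note inv = gradient_gibbs_invar[OF gibbs]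
  have "\<forall>x. \<exists>c. memoryless \<mu> x c"
    using extremal_memoryless[OF prob sets AE inv trivial] by blast
  then obtain c where mem: "\<And>x. memoryless \<mu> x (c x)" by metis
  have "prob UNIV = 1" using prob_space space by simp
  then have cyl: "measure \<mu> (cyl J k) = (\<Prod>x\<in>J. c x ^ nat (k x))" if "finite J" for J k
    using memoryless_cyl[OF finite_measure_axioms sets AE mem that, of k] by simp
  have "\<exists>a. 0 < a \<and> wt a = c x" for x
    using wt_surj[of "c x"] memoryless_less_1[OF prob sets cyl, of x] by metis
  then obtain a where a: "\<And>x. 0 < a x" "\<And>x. wt (a x) = c x" by metis
  define \<phi> where "\<phi> = restrict (\<lambda>e. a (fst e)) edges"
  have \<phi>: "\<phi> (x, p x) = a x" for x by (simp add: \<phi>_def)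
  \<comment> \<open>Invariance under adding 1 at \<open>x\<close> equates the probability
    \<open>c x\<close> of a positive increment at \<open>x\<close> with the probability that all
    children have positive increments, a limit of finite products; \<open>wt\<close> is
    injective.\<close>
  have "a x = (\<Sum>\<^sub>\<infinity>z\<in>{z. p z = x}. a z)" for x
  proof -
    let ?K = "{z. p z = x}" and ?F = "\<lambda>n. {z. p z = x \<and> to_nat z < n}"
    have fin: "finite (?F n)" for n
      by (rule finite_imageD[of to_nat]) (auto intro: finite_subset[of _ "{..<n}"] inj_onI)
    have U: "UNIV \<in> sets (gradient_algebra :: ('v \<Rightarrow> int) measure)"
      using sets.top[of gradient_algebra] by simp
    have "finite {v. site x v \<noteq> 0}" by (simp add: site_def)
    then have inv_site: "invar \<mu> (site x)" by (rule inv)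
    let ?A = "translate (\<lambda>v. - site x v) -` (M \<inter> cyl {x} (\<lambda>_. 1))"
    \<comment> \<open>Adding 1 at \<open>x\<close> maps the monotone functions with positive
      increment at \<open>x\<close> onto those with positive increments at all children.\<close>
    have A: "?A = M \<inter> cyl ?K (\<lambda>_. 1)"
    proof (intro equalityI subsetI)
      fix g assume "g \<in> ?A"
      then have h: "translate (\<lambda>v. - site x v) g \<in> M" "translate (\<lambda>v. - site x v) g \<in> cyl {x} (\<lambda>_. 1)" by auto
      then show "g \<in> M \<inter> cyl ?K (\<lambda>_. 1)"
        using translate_site_M[OF h(1), of x] translate_site_children[OF h(1), of x] by simp
    next
      fix g assume g: "g \<in> M \<inter> cyl ?K (\<lambda>_. 1)"
      then have "0 \<le> incr g y" "p y = x \<Longrightarrow> 1 \<le> incr g y" for y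
        by (auto simp: M_iff cyl_def)
      then have "0 \<le> incr (translate (\<lambda>v. - site x v) g) y" "1 \<le> incr (translate (\<lambda>v. - site x v) g) x" for y
        using parent_neq[of x] parent_neq[of y] by (auto simp: incr_translate site_def)
      then show "g \<in> ?A" by (simp add: M_iff cyl_def)
    qed
    have "emeasure \<mu> (translate (site x) -` ?A) = emeasure \<mu> ?A"
    proof (rule invarD[OF inv_site])
      show "?A \<subseteq> M" using A by blast
      show "translate (site x) -` ?A \<subseteq> M" by auto
    qed (intro translate_vimage_sets sets.Int M_sets cyl_sets)
    moreover have "translate (site x) -` ?A = M \<inter> cyl {x} (\<lambda>_. 1)" by auto
    ultimately have "prob (M \<inter> cyl {x} (\<lambda>_. 1)) = prob (M \<inter> cyl ?K (\<lambda>_. 1))"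
      using A by (simp add: measure_def)
    moreover have "prob (M \<inter> X) = prob X" if "X \<in> sets gradient_algebra" for X
      using AE that sets by (intro measure_eq_AE) (auto simp: M_sets)
    ultimately have "prob (cyl ?K (\<lambda>_. 1)) = c x"
      by (simp add: cyl_sets cyl)
    then have "(\<lambda>n. measure \<mu> (cyl (?F n) (\<lambda>_. 1) \<inter> UNIV)) \<longlonglongrightarrow> c x"
      using children_measure_tendsto[OF finite_measure_axioms sets U, of x] by simp
    then have "(\<lambda>n. \<Prod>z\<in>?F n. wt (a z)) \<longlonglongrightarrow> wt (a x)"
      by (simp add: cyl fin a)
    then have "wt (a x) = wt (\<Sum>\<^sub>\<infinity>z\<in>?K. a z)"
      using children_product_tendsto by (rule LIMSEQ_unique)
    then show ?thesis by (simp add: wt_inject)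
  qed
  then have "\<phi> \<in> flows edges"
    unfolding flows_iff \<phi> using a(1) restrict_extensional[of _ edges] \<phi>_def by blast
  moreover have "is_flow_measure edges \<phi> \<mu>"
    using prob sets by (rule cyl_flow_measure) (simp_all add: \<phi> a cyl)
  then have "flow_measure edges \<phi> = \<mu>"
    using flow_measure_is_flow[of \<phi>] by (intro flow_measure_unique[of \<phi>]) (simp_all add: \<phi> a)
  ultimately show ?thesis by blast
qed

text \<open>The probability of a positive increment on an edge is the \<open>wt\<close> of its flow
  value and so determines that value.\<close>

lemma flow_measure_inj: "inj_on (flow_measure edges) (flows edges)"
proof (rule inj_onI)
  fix \<phi> \<psi> assume \<phi>: "\<phi> \<in> flows edges" and \<psi>: "\<psi> \<in> flows edges"
    and eq: "flow_measure edges \<phi> = flow_measure edges \<psi>"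
  have pos: "\<And>x. 0 < \<phi> (x, p x)" "\<And>x. 0 < \<psi> (x, p x)"
    using \<phi> \<psi> unfolding flows_iff by blast+
  have "wt (\<phi> (x, p x)) = wt (\<psi> (x, p x))" for x
    using flow_measure_cyl[of \<phi> _ "{x}" "\<lambda>_. 1", OF flow_measure_is_flow]
      flow_measure_cyl[of \<psi> _ "{x}" "\<lambda>_. 1", OF flow_measure_is_flow] pos eq by simp
  then have "\<phi> (x, p x) = \<psi> (x, p x)" for x by (simp add: wt_inject)
  moreover have "\<phi> \<in> extensional edges" "\<psi> \<in> extensional edges"
    using \<phi> \<psi> unfolding flows_iff by blast+
  ultimately show "\<phi> = \<psi>"
    by (intro extensionalityI[of _ edges]) auto
qed

end

theorem theorem2p11:
  fixes E :: "('v::countable \<times> 'v) set"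
  assumes "directed_tree E"
    and "\<forall>x. \<exists>!y. (x, y) \<in> E"
    and "\<forall>x. \<exists>y. (y, x) \<in> E"
  shows "bij_betw (flow_measure E) (flows E) {\<mu>. extremal_gradient_gibbs E \<mu>}"
proof -
  obtain p where p: "\<And>x. (x, p x) \<in> E" "\<And>x y. (x, y) \<in> E \<Longrightarrow> y = p x"
    using assms(2) by metis
  then have E: "E = range (\<lambda>x. (x, p x))" by auto
  interpret parent_map p
  proof (rule tree_parent_map)
    show "directed_tree (range (\<lambda>x. (x, p x)))" using assms(1) E by simp
    fix x
    obtain y where "(y, x) \<in> E" using assms(3) by blast
    then have "p y = x" using p(2)[of y x] by simp
    then show "\<exists>y. p y = x" ..
  qed
  show ?thesis
    unfolding E bij_betw_def
    using flow_measure_inj flow_measure_extremal extremal_is_flow_measure by blast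
qed

end
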